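(* Let $\alpha\in(0,2)$ and let $w$ be a probability density on $[0,1]$ that is continuous on $[0,1)$, and let $\{\tau_n\}$ be a $w$-pre-chaotic sequence of probability measures on the standard simplices. Let $(\alpha_n)$ be a sequence in $(0,2)$ with $\alpha_n\to\alpha$, define the maps $T_n$ in terms of $\alpha_n$, let $\hat\tau_n$ be the push-forward of $\tau_n$ onto $S_n$ under $T_n$, averaged over permutations, and let $\mu_n$ be the associated empirical measures. Define the increasing function $$\phi(\xi)=\Big(1-\frac\alpha2\Big)\int_0^\xi\frac{w(t)}{1-t}\,dt+\alpha\xi,\qquad \xi\in[0,1),$$ and $g(x)=\frac{1}{\phi'(\phi^{-1}(x))}$. Then $g$ is a probability density on $[0,\infty)$ and $W_1(\mu_n,g(x)\,dx)\to0$ as $n\to\infty$ (in probability).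
   Context: $S_1^{(n)}=\{(\tilde z_1,\dots,\tilde z_n)\in[0,\infty)^n:\sum_j\tilde z_j=1\}$. A sequence $\{\tau_n\}$ of probability measures on $S_1^{(n)}$ is $w$-pre-chaotic if, writing $n\mathbb{E}_{\tau_n}[\tilde z_j]=w(j/n)+r_n(j)$, for each $0<\xi_*<1$ there is $C<\infty$ depending only on $\xi_*$ such that for each $\epsilon>0$ there is $n_\epsilon$ with, for all $n>n_\epsilon$ and $j,k<n\xi_*$: $|r_n(j)|<\epsilon$, $\mathrm{Var}[\tilde z_j]\le C\epsilon/n$, $|\mathrm{Cov}(\tilde z_j,\tilde z_k)|\le C\epsilon/n^2$. The set $S_n=\{x\in[0,\infty)^n:\sum x_j=n,\ |x_j-x_k|\ge\alpha_n/(n-1)\ \forall j\neq k\}$. The map $T_n:S_1^{(n)}\to S_n$ is $T_n(\tilde z)_j=n(1-\frac{\alpha_n}2)\sum_{i=1}^j\frac{\tilde z_i}{n+1-i}+\frac{j-1}{n-1}\alpha_n$. "Push-forward averaged over permutations": the law of $(x_{\pi(1)},\dots,x_{\pi(n)})$ where $x=T_n(\tilde z)$, $\tilde z\sim\tau_n$, and $\pi$ is an independent uniform random permutation. The empirical measure is $\mu_n=\frac1n\sum_j\delta_{x_j}$. $W_1$ is the Kantorovich–Rubinstein distance $W_1(\mu,\nu)=\sup\{|\int\chi d\mu-\int\chi d\nu|:\chi\ 1\text{-Lipschitz}\}$. *)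

theory Defs
  imports "HOL-Probability.Probability" "HOL-Combinatorics.Permutations" "HOL-Analysis.Lipschitz"
begin

text \<open>Indices run over 1..n as in the paper. Vectors are functions nat => real,
  measures on them live on the product sigma-algebra PiM {1..n} borel.\<close>

definition std_simplex :: "nat \<Rightarrow> (nat \<Rightarrow> real) set" where
  "std_simplex n = {z \<in> space (PiM {1..n} (\<lambda>_. borel)).
      (\<forall>j\<in>{1..n}. 0 \<le> z j) \<and> (\<Sum>j=1..n. z j) = 1}"

definition coord_mean :: "(nat \<Rightarrow> real) measure \<Rightarrow> nat \<Rightarrow> real" where
  "coord_mean M j = (\<integral>z. z j \<partial>M)"

definition coord_cov :: "(nat \<Rightarrow> real) measure \<Rightarrow> nat \<Rightarrow> nat \<Rightarrow> real" where
  "coord_cov M j k = (\<integral>z. (z j - coord_mean M j) * (z k - coord_mean M k) \<partial>M)"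

definition coord_var :: "(nat \<Rightarrow> real) measure \<Rightarrow> nat \<Rightarrow> real" where
  "coord_var M j = coord_cov M j j"

definition pre_chaotic :: "(real \<Rightarrow> real) \<Rightarrow> (nat \<Rightarrow> (nat \<Rightarrow> real) measure) \<Rightarrow> bool" where
  "pre_chaotic w \<tau> \<longleftrightarrow>
    (\<forall>\<xi>s. 0 < \<xi>s \<and> \<xi>s < 1 \<longrightarrow>
      (\<exists>C::real. \<forall>\<epsilon>>0. \<exists>n\<epsilon>::nat. \<forall>n>n\<epsilon>. \<forall>j k.
         1 \<le> j \<and> 1 \<le> k \<and> real j < real n * \<xi>s \<and> real k < real n * \<xi>s \<longrightarrow>
           \<bar>real n * coord_mean (\<tau> n) j - w (real j / real n)\<bar> < \<epsilon>
         \<and> coord_var (\<tau> n) j \<le> C * \<epsilon> / real n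
         \<and> (j \<noteq> k \<longrightarrow> \<bar>coord_cov (\<tau> n) j k\<bar> \<le> C * \<epsilon> / (real n)^2)))"

definition T_map :: "real \<Rightarrow> nat \<Rightarrow> (nat \<Rightarrow> real) \<Rightarrow> (nat \<Rightarrow> real)" where
  "T_map an n z = (\<lambda>j\<in>{1..n}. real n * (1 - an / 2) * (\<Sum>i=1..j. z i / real (n + 1 - i))
                              + (real j - 1) / (real n - 1) * an)"

definition perms_pmf :: "nat \<Rightarrow> (nat \<Rightarrow> nat) pmf" where
  "perms_pmf n = pmf_of_set {\<pi>. \<pi> permutes {1..n}}"

definition hat_tau :: "(nat \<Rightarrow> (nat \<Rightarrow> real) measure) \<Rightarrow> (nat \<Rightarrow> real) \<Rightarrow> nat \<Rightarrow> (nat \<Rightarrow> real) measure" where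
  "hat_tau \<tau> a n = distr (\<tau> n \<Otimes>\<^sub>M measure_pmf (perms_pmf n)) (PiM {1..n} (\<lambda>_. borel))
      (\<lambda>(z, \<pi>). \<lambda>j\<in>{1..n}. T_map (a n) n z (\<pi> j))"

definition emp_measure :: "nat \<Rightarrow> (nat \<Rightarrow> real) \<Rightarrow> real measure" where
  "emp_measure n x = measure_pmf (pmf_of_multiset (image_mset x (mset_set {1..n})))"

definition W1 :: "real measure \<Rightarrow> real measure \<Rightarrow> ereal" where
  "W1 M N = (SUP f\<in>{f. lipschitz_on 1 UNIV f}. ereal \<bar>(\<integral>x. f x \<partial>M) - (\<integral>x. f x \<partial>N)\<bar>)"

definition phi :: "real \<Rightarrow> (real \<Rightarrow> real) \<Rightarrow> real \<Rightarrow> real" where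
  "phi \<alpha> w \<xi> = (1 - \<alpha> / 2) * integral {0..\<xi>} (\<lambda>t. w t / (1 - t)) + \<alpha> * \<xi>"

definition phi_deriv :: "real \<Rightarrow> (real \<Rightarrow> real) \<Rightarrow> real \<Rightarrow> real" where
  "phi_deriv \<alpha> w \<xi> = (THE D. (phi \<alpha> w has_real_derivative D) (at \<xi> within {0..<1}))"

definition g_dens :: "real \<Rightarrow> (real \<Rightarrow> real) \<Rightarrow> real \<Rightarrow> real" where
  "g_dens \<alpha> w x = (if x \<in> phi \<alpha> w ` {0..<1}
      then 1 / phi_deriv \<alpha> w (the_inv_into {0..<1} (phi \<alpha> w) x) else 0)"

definition g_measure :: "real \<Rightarrow> (real \<Rightarrow> real) \<Rightarrow> real measure" where
  "g_measure \<alpha> w = density lborel (\<lambda>x. ennreal (g_dens \<alpha> w x))"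

end

theory Submission
  imports Defs
begin

text \<open>The map \<open>\<phi>\<close> transports the uniform law on \<open>[0, 1)\<close> to \<open>g(x) dx\<close>, so the integral of a
  1-Lipschitz \<open>f\<close> against \<open>g\<close> is the integral of \<open>f \<circ> \<phi>\<close>, and \<open>\<mu>\<^sub>n\<close> is compared with it by
  coupling \<open>x\<^sub>j\<close> with \<open>\<phi>(j/n)\<close>. Both measures have mean 1. Hence the contribution of the indices
  \<open>j > m\<close>, where pre-chaoticity gives no information, is controlled by that of \<open>j \<le> m\<close>: the first
  moment missing there is \<open>1 - \<integral> \<phi>\<close> over \<open>[0, m/n]\<close>, up to the error already made, and it is small once \<open>m/n\<close>
  is close to 1. For \<open>j \<le> m\<close> the mean of \<open>T\<^sub>n(z)\<^sub>j\<close> is a Riemann sum converging uniformly to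
  \<open>\<phi>(j/n)\<close>, its variance tends to 0 by the covariance bounds, and Markov's inequality concludes.\<close>

section \<open>Calculus on half-open intervals and inverses of monotone functions\<close>

lemma at_within_Icc_eq_Ico:
  fixes x a b c :: real
  assumes "a \<le> x" "x < c" "c < b"
  shows "at x within {a..c} = at x within {a..<b}"
  by (rule at_within_nhd[where S="{..<c}"]) (use assms in auto)

text \<open>Continuity is available on \<open>{a..<b}\<close> only, and \<open>f\<close> may blow up
  at \<open>b\<close>. Differentiability at \<open>x\<close> is a local matter, so the fundamental
  theorem is applied on a compact \<open>{a..c}\<close> with \<open>x < c < b\<close>.\<close>

lemma integral_has_real_derivative_Ico:
  fixes f :: "real \<Rightarrow> real"
  assumes f: "continuous_on {a..<b} f" and x: "x \<in> {a..<b}"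
  shows "((\<lambda>y. integral {a..y} f) has_real_derivative f x) (at x within {a..<b})"
proof -
  obtain c where c: "x < c" "c < b"
    using dense[of x b] x by auto
  have "continuous_on {a..c} f"
    using f by (rule continuous_on_subset) (use c in auto)
  then have "((\<lambda>y. integral {a..y} f) has_real_derivative f x) (at x within {a..c})"
    by (rule integral_has_real_derivative) (use x c in auto)
  then show ?thesis
    using at_within_Icc_eq_Ico[of a x c b] x c by simp
qed

text \<open>The inverse is again monotone on the image, and monotone functions are Borel. This
  serves the measurability of \<open>g_dens\<close>, which is built from the inverse of
  \<phi>.\<close>

lemma borel_measurable_the_inv_into_strict_mono:
  fixes f :: "real \<Rightarrow> real"
  assumes f: "strict_mono_on A f"
  shows "the_inv_into A f \<in> borel_measurable (restrict_space borel (f ` A))"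
proof (rule borel_measurable_mono_on_fnc, rule mono_onI)
  have inj: "inj_on f A"
    using f by (rule strict_mono_on_imp_inj_on)
  fix r s assume rs: "r \<in> f ` A" "s \<in> f ` A" "r \<le> s"
  then obtain x y where xy: "x \<in> A" "y \<in> A" "r = f x" "s = f y"
    by auto
  then have "\<not> y < x"
    using f rs(3) by (meson linorder_not_le strict_mono_onD)
  then show "the_inv_into A f r \<le> the_inv_into A f s"
    using xy inj by (simp add: the_inv_into_f_f)
qed

lemma has_integral_Icc_iff_Ico:
  fixes f :: "real \<Rightarrow> 'a::banach"
  shows "(f has_integral I) {a..b} \<longleftrightarrow> (f has_integral I) {a..<b}"
proof (rule has_integral_spike_set_eq)
  show "negligible {x \<in> {a..b} - {a..<b}. f x \<noteq> 0}"
    by (rule negligible_subset[of "{b}"]) auto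
  show "negligible {x \<in> {a..<b} - {a..b}. f x \<noteq> 0}"
    by (rule negligible_subset[of "{}"]) auto
qed

section \<open>The limit profile \<phi> and the density \<open>g_dens\<close>\<close>

locale limit_profile =
  fixes \<alpha> :: real and w :: "real \<Rightarrow> real"
  assumes alpha_pos: "0 < \<alpha>" and alpha_less: "\<alpha> < 2"
    and w_nonneg: "t \<in> {0..1} \<Longrightarrow> 0 \<le> w t"
    and w_int: "(w has_integral 1) {0..1}"
    and w_cont: "continuous_on {0..<1} w"
begin

abbreviation h where "h t \<equiv> w t / (1 - t)"

abbreviation \<phi> where "\<phi> \<equiv> phi \<alpha> w"

text \<open>Closed form standing in for \<open>phi_deriv\<close>, which is a definite description;
  \<open>phi_deriv_eq\<close> identifies the two.\<close>

definition \<phi>' where "\<phi>' x = (1 - \<alpha> / 2) * h x + \<alpha>"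

lemma h_cont: "continuous_on {0..<1} h"
  by (intro continuous_intros w_cont) auto

lemma h_nonneg: "t \<in> {0..<1} \<Longrightarrow> 0 \<le> h t"
  using w_nonneg[of t] by auto

lemma phi_has_derivative:
  assumes "x \<in> {0..<1}"
  shows "(\<phi> has_real_derivative \<phi>' x) (at x within {0..<1})"
  unfolding phi_def[abs_def] \<phi>'_def
  by (rule derivative_eq_intros integral_has_real_derivative_Ico[OF h_cont assms] refl | simp)+

text \<open>The linear term of \<phi> alone contributes \<alpha> to the slope. This keeps
  \<open>1 / \<phi>' x\<close> positive and away from division by zero.\<close>

lemma \<phi>'_ge: "x \<in> {0..<1} \<Longrightarrow> \<alpha> \<le> \<phi>' x"
  using mult_nonneg_nonneg[OF _ h_nonneg[of x], of "1 - \<alpha> / 2"] alpha_less unfolding \<phi>'_def by simp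

lemma phi_deriv_eq:
  assumes x: "x \<in> {0..<1}"
  shows "phi_deriv \<alpha> w x = \<phi>' x"
  unfolding phi_deriv_def
proof (rule the_equality)
  show "(\<phi> has_real_derivative \<phi>' x) (at x within {0..<1})"
    using x by (rule phi_has_derivative)
  fix D assume D: "(\<phi> has_real_derivative D) (at x within {0..<1})"
  \<comment> \<open>Derivatives within a set are unique only at accumulation points; at
    \<open>x = 0\<close> the derivative is one-sided.\<close>
  have "at x within {0..<1} \<noteq> bot"
    using x by (simp add: trivial_limit_within islimpt_Ico)
  then show "D = \<phi>' x"
    using D phi_has_derivative[OF x] vector_derivative_unique_within
    unfolding has_real_derivative_iff_has_vector_derivative by blast
qed

lemma phi_cont: "continuous_on {0..<1} \<phi>"
  using phi_has_derivative by (meson DERIV_continuous continuous_on_eq_continuous_within)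

lemma phi_0: "\<phi> 0 = 0"
  by (simp add: phi_def)

text \<open>The integral term is only weakly increasing, since \<open>w\<close> may vanish on
  intervals; strictness comes from the term \<open>\<alpha> * \<xi>\<close>.\<close>

lemma phi_strict_mono: "strict_mono_on {0..<1} \<phi>"
proof (rule strict_mono_onI)
  fix r s :: real assume rs: "r \<in> {0..<1}" "s \<in> {0..<1}" "r < s"
  have int: "h integrable_on {0..x}" if "x < 1" for x
    by (rule integrable_continuous_real, rule continuous_on_subset[OF h_cont]) (use that in auto)
  have "integral {0..r} h \<le> integral {0..s} h"
    by (rule integral_subset_le) (use rs int h_nonneg in auto)
  then show "\<phi> r < \<phi> s"
    using rs(3) alpha_pos alpha_less unfolding phi_def
    by (intro add_le_less_mono mult_left_mono mult_strict_left_mono) auto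
qed

lemma phi_mono: "0 \<le> x \<Longrightarrow> x \<le> y \<Longrightarrow> y < 1 \<Longrightarrow> \<phi> x \<le> \<phi> y"
  using strict_mono_onD[OF phi_strict_mono, of x y] by (cases "x = y") auto

lemma phi_nonneg: "x \<in> {0..<1} \<Longrightarrow> 0 \<le> \<phi> x"
  using phi_mono[of 0 x] phi_0 by auto

lemma inj_phi: "inj_on \<phi> {0..<1}"
  using phi_strict_mono by (rule strict_mono_on_imp_inj_on)

lemma g_dens_phi: "x \<in> {0..<1} \<Longrightarrow> g_dens \<alpha> w (\<phi> x) = 1 / \<phi>' x"
  unfolding g_dens_def using inj_phi by (simp add: the_inv_into_f_f phi_deriv_eq)

lemma g_dens_nonneg: "0 \<le> g_dens \<alpha> w x"
proof (cases "x \<in> \<phi> ` {0..<1}")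
  case True
  then obtain t where "t \<in> {0..<1}" "x = \<phi> t"
    by auto
  then show ?thesis
    using g_dens_phi[of t] \<phi>'_ge[of t] alpha_pos by auto
qed (simp add: g_dens_def)

text \<open>A continuous image of an interval is an interval, whether \<phi> is bounded or tends to
  infinity at 1.\<close>

lemma phi_image_borel: "\<phi> ` {0..<1} \<in> sets borel"
proof -
  have "connected (\<phi> ` {0..<1})"
    by (intro connected_continuous_image phi_cont) simp
  then show ?thesis
    using is_real_interval[of "\<phi> ` {0..<1}"] by (auto simp: is_interval_connected_1)
qed

text \<open>On the range of \<phi> the density is the continuous function
  \<open>1 / \<phi>' x\<close> after the monotone inverse of \<phi>; it is extended by 0 off this
  Borel set.\<close>

lemma g_dens_measurable [measurable]: "g_dens \<alpha> w \<in> borel_measurable borel"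
proof -
  let ?S = "{0..<1} :: real set" and ?T = "\<phi> ` {0..<1}"
  have inv: "the_inv_into ?S \<phi> \<in> measurable (restrict_space borel ?T) (restrict_space borel ?S)"
    using borel_measurable_the_inv_into_strict_mono[OF phi_strict_mono]
    by (rule measurable_restrict_space2[rotated])
       (auto simp: space_restrict_space the_inv_into_f_f[OF inj_phi])
  have "continuous_on ?S (\<lambda>x. 1 / \<phi>' x)"
    unfolding \<phi>'_def using \<phi>'_ge alpha_pos
    by (intro continuous_intros h_cont) (force simp: \<phi>'_def)
  then have "(\<lambda>x. 1 / \<phi>' x) \<in> borel_measurable (restrict_space borel ?S)"
    by (rule borel_measurable_continuous_on_restrict)
  from measurable_compose[OF inv this]
  have "(\<lambda>x. if x \<in> ?T then 1 / \<phi>' (the_inv_into ?S \<phi> x) else 0) \<in> borel_measurable borel"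
    by (subst (asm) measurable_restrict_space_iff[where c=0]) (use phi_image_borel in auto)
  also have "(\<lambda>x. if x \<in> ?T then 1 / \<phi>' (the_inv_into ?S \<phi> x) else 0) = g_dens \<alpha> w"
    by (auto simp: g_dens_def fun_eq_iff the_inv_into_f_f[OF inj_phi] phi_deriv_eq)
  finally show ?thesis .
qed

section \<open>Behaviour at the endpoint 1 and the mean of the limit law\<close>

lemma w_integral_tendsto: "((\<lambda>x. integral {0..x} w) \<longlongrightarrow> 1) (at_left 1)"
proof -
  have "continuous_on {0..1} (\<lambda>x. integral {0..x} w)"
    using w_int by (intro indefinite_integral_continuous_1) blast
  then have "((\<lambda>x. integral {0..x} w) \<longlongrightarrow> integral {0..1} w) (at 1 within {0..1})"
    by (auto simp: continuous_on)
  then show ?thesis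
    using w_int by (simp add: integral_unique at_within_Icc_at_left)
qed

text \<open>Splitting at a point \<open>s\<close> close to 1: the part of the integral beyond \<open>s\<close> is controlled by
  \<open>(1 - x) / (1 - t) \<le> 1\<close>, the part before \<open>s\<close> by the factor \<open>1 - x\<close>.\<close>

lemma phi_mult_tendsto: "((\<lambda>x. (1 - x) * \<phi> x) \<longlongrightarrow> 0) (at_left 1)"
proof -
  have int: "h integrable_on {x..y}" "w integrable_on {x..y}" if "0 \<le> x" "y < 1" for x y
    using that by (auto intro!: integrable_continuous_real continuous_on_subset[OF h_cont]
        continuous_on_subset[OF w_cont])
  have "((\<lambda>x. (1 - x) * integral {0..x} h) \<longlongrightarrow> 0) (at_left 1)"
  proof (rule tendstoI)
    fix e :: real assume e: "0 < e"
    have "\<forall>\<^sub>F s in at_left 1. 0 < s \<and> dist (integral {0..s} w) 1 < e / 2"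
      using tendstoD[OF w_integral_tendsto half_gt_zero[OF e]] eventually_at_left_real[OF zero_less_one]
      by eventually_elim auto
    moreover have "\<forall>\<^sub>F s in at_left 1. s < (1::real)"
      using eventually_at_left_real[of 0 "1::real"] by (auto elim: eventually_mono)
    ultimately obtain s where s: "0 < s" "s < 1" "dist (integral {0..s} w) 1 < e / 2"
      using eventually_happens'[OF trivial_limit_at_left_real eventually_conj] by blast
    have "((\<lambda>x. (1 - x) * integral {0..s} h) \<longlongrightarrow> (1 - 1) * integral {0..s} h) (at_left 1)"
      by (intro tendsto_intros)
    then have "\<forall>\<^sub>F x in at_left 1. (1 - x) * integral {0..s} h < e / 2"
      using e by (intro order_tendstoD(2)[where y="(1 - 1) * integral {0..s} h"]) auto
    then show "\<forall>\<^sub>F x in at_left 1. dist ((1 - x) * integral {0..x} h) 0 < e"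
      using eventually_at_left_real[OF s(2)]
    proof eventually_elim
      case (elim x)
      have x: "s < x" "x < 1" using elim by auto
      have "integral {0..x} h = integral {0..s} h + integral {s..x} h"
        using s x int[of 0 x] by (intro Henstock_Kurzweil_Integration.integral_combine[symmetric]) auto
      then have "(1 - x) * integral {0..x} h = (1 - x) * integral {0..s} h + (1 - x) * integral {s..x} h"
        by (simp add: distrib_left)
      moreover have "integral {s..1} w < e / 2"
      proof -
        have "integral {0..s} w + integral {s..1} w = integral {0..1} w"
          using s w_int by (intro Henstock_Kurzweil_Integration.integral_combine) auto
        then show ?thesis
          using s(3) unfolding dist_real_def integral_unique[OF w_int] by linarith
      qed
      moreover have "(1 - x) * integral {s..x} h \<le> integral {s..1} w"
      proof -
        have "(1 - x) * integral {s..x} h = integral {s..x} (\<lambda>t. (1 - x) * h t)"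
          by (rule integral_mult_right[symmetric])
        also have "\<dots> \<le> integral {s..x} w"
        proof (rule integral_le)
          fix t assume t: "t \<in> {s..x}"
          have "(1 - x) * w t \<le> (1 - t) * w t"
            using t x s by (intro mult_right_mono w_nonneg) auto
          then show "(1 - x) * h t \<le> w t"
            using t x by (simp add: divide_simps mult.commute)
        qed (use s x int[of s x] integrable_on_mult_right[of h "{s..x}" "1 - x"] in auto)
        also have "\<dots> \<le> integral {s..1} w"
          using s x int[of s x] w_int integrable_subinterval_real[of w 0 1 s 1]
          by (intro integral_subset_le) (auto intro!: w_nonneg)
        finally show ?thesis .
      qed
      moreover have "0 \<le> (1 - x) * integral {0..x} h"
        using x int[of 0 x] h_nonneg s by (intro mult_nonneg_nonneg integral_nonneg) auto
      ultimately have "\<bar>(1 - x) * integral {0..x} h\<bar> < e"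
        using elim(1) by linarith
      then show ?case
        by (simp add: dist_real_def)
    qed
  qed
  then have "((\<lambda>x. (1 - \<alpha> / 2) * ((1 - x) * integral {0..x} h) + \<alpha> * x * (1 - x))
      \<longlongrightarrow> (1 - \<alpha> / 2) * 0 + \<alpha> * 1 * (1 - 1)) (at_left 1)"
    by (intro tendsto_intros)
  moreover have "(\<lambda>x. (1 - x) * \<phi> x) = (\<lambda>x. (1 - \<alpha> / 2) * ((1 - x) * integral {0..x} h) + \<alpha> * x * (1 - x))"
    by (simp add: fun_eq_iff phi_def field_simps)
  ultimately show ?thesis
    by simp
qed

text \<open>Integration by parts: the boundary term \<open>(1 - x) * \<phi> x\<close> vanishes at
  both ends, so \<phi> has the same integral as \<open>(1 - x) * \<phi>' x\<close>. The factor
  \<open>1 - x\<close> cancels the singularity of \<open>h\<close> and leaves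
  \<open>(1 - \<alpha> / 2) * w x + \<alpha> * (1 - x)\<close>, whose integral is
  \<open>(1 - \<alpha> / 2) + \<alpha> / 2\<close>. This is the statement that the limit law has
  mean 1.\<close>

lemma phi_integral_Ioo:
  shows "set_integrable lborel {0<..<1} \<phi>" "(LBINT x:{0<..<1}. \<phi> x) = 1"
proof -
  \<comment> \<open>Antiderivative of \<phi> produced by the integration by parts; the first two
    terms are a primitive of \<open>(1 - x) * \<phi>' x\<close>.\<close>
  define F where "F x = (1 - \<alpha> / 2) * integral {0..x} w + \<alpha> * (x - x\<^sup>2 / 2) - (1 - x) * \<phi> x" for x
  have at_within_eq: "at x within {0..<1} = at x" if "0 < x" "x < 1" for x :: real
    by (rule at_within_interior) (use that in simp)
  have \<phi>'_mult: "(1 - x) * \<phi>' x = (1 - \<alpha> / 2) * w x + \<alpha> * (1 - x)" if "x < 1" for x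
    using that by (simp add: \<phi>'_def field_simps)
  have F_within: "(F has_real_derivative \<phi> x) (at x within {0..<1})" if x: "x \<in> {0..<1}" for x
    unfolding F_def
    using x \<phi>'_mult[of x]
    by (auto intro!: derivative_eq_intros integral_has_real_derivative_Ico[OF w_cont x]
          phi_has_derivative[OF x] simp: algebra_simps)
  have F: "(F has_real_derivative \<phi> x) (at x)" if "0 < x" "x < 1" for x
    using F_within[of x] at_within_eq[OF that] that by simp
  have "(F \<longlongrightarrow> F 0) (at 0 within {0..<1})"
    using DERIV_continuous[OF F_within[of 0]] by (simp add: continuous_within)
  moreover have "at 0 within {0..<1} = at_right (0::real)"
    by (rule at_within_nhd[where S="{..<1}"]) auto
  ultimately have F0: "(F \<longlongrightarrow> 0) (at_right 0)"
    by (simp add: F_def phi_0)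
  have "(F \<longlongrightarrow> (1 - \<alpha> / 2) * 1 + \<alpha> * (1 - 1\<^sup>2 / 2) - 0) (at_left 1)"
    unfolding F_def by (intro tendsto_intros w_integral_tendsto phi_mult_tendsto) auto
  then have F1: "(F \<longlongrightarrow> 1) (at_left 1)"
    by simp
  have isC: "isCont \<phi> x" if "0 < x" "x < 1" for x
    using phi_has_derivative[of x] at_within_eq[OF that] that DERIV_isCont by simp
  have "((F \<circ> real_of_ereal) \<longlongrightarrow> 0) (at_right (ereal 0))"
    "((F \<circ> real_of_ereal) \<longlongrightarrow> 1) (at_left (ereal 1))"
    unfolding ereal_tendsto_simps using F0 F1 by auto
  \<comment> \<open>As \<phi> is nonnegative, finite limits of \<open>F\<close> at both ends yield
    integrability as well as the value.\<close>
  note FTC = interval_integral_FTC_nonneg[OF _ _ _ _ this, of \<phi>]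
  show "set_integrable lborel {0<..<1} \<phi>"
    unfolding einterval_eq(1)[symmetric] by (rule FTC(1)) (use F isC phi_nonneg in auto)
  have "(LBINT x=ereal 0..ereal 1. \<phi> x) = 1 - 0"
    by (rule FTC(2)) (use F isC phi_nonneg in auto)
  then show "(LBINT x:{0<..<1}. \<phi> x) = 1"
    by (simp add: interval_lebesgue_integral_def)
qed

lemma phi_integral:
  shows "\<phi> absolutely_integrable_on {0..<1}" "integral {0..<1} \<phi> = 1"
proof -
  have *: "(\<phi> has_integral 1) {0<..<1}"
    using set_borel_integral_eq_integral[OF phi_integral_Ioo(1)] phi_integral_Ioo(2)
    by (simp add: has_integral_integrable_integral)
  then have "(\<phi> has_integral 1) {0..<1}"
    by (simp add: has_integral_Icc_iff_Ioo[symmetric] has_integral_Icc_iff_Ico[symmetric])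
  then show "\<phi> absolutely_integrable_on {0..<1}" "integral {0..<1} \<phi> = 1"
    using phi_nonneg absolutely_integrable_on_iff_nonneg[of "{0..<1}" \<phi>] by auto
qed

section \<open>Transport of the uniform law on \<open>{0..<1}\<close> to the density
  \<open>g_dens\<close>\<close>

text \<open>Substituting \<open>x = \<phi> t\<close> produces the Jacobian \<open>\<phi>' t\<close>,
  which cancels \<open>g_dens \<alpha> w (\<phi> t) = 1 / \<phi>' t\<close>.\<close>

lemma change_of_variables:
  assumes "(\<lambda>x. f (\<phi> x)) absolutely_integrable_on {0..<1}"
  shows "(\<lambda>x. g_dens \<alpha> w x * f x) absolutely_integrable_on UNIV"
    "integral UNIV (\<lambda>x. g_dens \<alpha> w x * f x) = integral {0..<1} (\<lambda>x. f (\<phi> x))"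
proof -
  let ?S = "{0..<1} :: real set" and ?g = "\<lambda>x. g_dens \<alpha> w x * f x"
  have eq: "\<bar>\<phi>' x\<bar> * ?g (\<phi> x) = f (\<phi> x)" if "x \<in> ?S" for x
    using \<phi>'_ge[OF that] alpha_pos by (simp add: g_dens_phi[OF that])
  have "(\<lambda>x. \<bar>\<phi>' x\<bar> * ?g (\<phi> x)) absolutely_integrable_on ?S"
    by (rule set_integrable_cong[THEN iffD2, OF refl refl eq assms])
  moreover have "integral ?S (\<lambda>x. \<bar>\<phi>' x\<bar> * ?g (\<phi> x)) = integral ?S (\<lambda>x. f (\<phi> x))"
    by (rule integral_cong) (rule eq)
  ultimately have "(\<lambda>x. \<bar>\<phi>' x\<bar> * ?g (\<phi> x)) absolutely_integrable_on ?S \<and>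
      integral ?S (\<lambda>x. \<bar>\<phi>' x\<bar> * ?g (\<phi> x)) = integral ?S (\<lambda>x. f (\<phi> x))"
    by blast
  then have *: "?g absolutely_integrable_on \<phi> ` ?S \<and> integral (\<phi> ` ?S) ?g = integral ?S (\<lambda>x. f (\<phi> x))"
    by (subst (asm) has_absolute_integral_change_of_variables_1'[OF _ phi_has_derivative inj_phi]) auto
  \<comment> \<open>Off the range of \<phi> the density is 0 by definition, so the integral over the
    range is the integral over the whole line.\<close>
  have "(\<lambda>x. if x \<in> \<phi> ` ?S then ?g x else 0) = ?g"
    by (auto simp: g_dens_def)
  then show "?g absolutely_integrable_on UNIV" "integral UNIV ?g = integral ?S (\<lambda>x. f (\<phi> x))"
    using * absolutely_integrable_restrict_UNIV[of "\<phi> ` ?S" ?g] integral_restrict_UNIV[of "\<phi> ` ?S" ?g]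
    by simp_all
qed

lemma g_dens_has_integral: "(g_dens \<alpha> w has_integral 1) {0..}"
proof -
  have 1: "((\<lambda>x. 1::real) has_integral 1) {0..<1::real}"
    using has_integral_const_real[of "1::real" 0 1] by (simp add: has_integral_Icc_iff_Ico)
  then have "(\<lambda>x. 1::real) absolutely_integrable_on {0..<1::real}"
    by (auto simp: absolutely_integrable_on_iff_nonneg)
  with integral_unique[OF 1] have "(g_dens \<alpha> w has_integral 1) UNIV"
    using change_of_variables[of "\<lambda>_. 1"]
    by (auto simp: absolutely_integrable_on_def has_integral_integrable_integral)
  moreover have "(\<lambda>x. if x \<in> {0..} then g_dens \<alpha> w x else 0) = g_dens \<alpha> w"
    using phi_nonneg by (auto simp: g_dens_def fun_eq_iff)
  ultimately show ?thesis
    using has_integral_restrict_UNIV[of "{0..}" "g_dens \<alpha> w" 1] by simp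
qed

text \<open>The change of variables lives on Lebesgue measure; continuity of \<open>f\<close> makes
  the integrand Borel, which brings the identity back to \<open>lborel\<close>.\<close>

lemma integral_g_measure:
  fixes f :: "real \<Rightarrow> real"
  assumes f: "continuous_on UNIV f" and int: "(\<lambda>x. f (\<phi> x)) absolutely_integrable_on {0..<1}"
  shows "(\<integral>x. f x \<partial>g_measure \<alpha> w) = integral {0..<1} (\<lambda>x. f (\<phi> x))"
proof -
  have f_m [measurable]: "f \<in> borel_measurable borel"
    using f by (rule borel_measurable_continuous_onI)
  have "(\<integral>x. f x \<partial>g_measure \<alpha> w) = (\<integral>x. g_dens \<alpha> w x * f x \<partial>lborel)"
    unfolding g_measure_def using g_dens_nonneg by (subst integral_density) auto
  also have "integrable lborel (\<lambda>x. g_dens \<alpha> w x * f x)"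
    using change_of_variables(1)[OF int]
    by (simp add: set_integrable_def integrable_completion)
  then have "(\<integral>x. g_dens \<alpha> w x * f x \<partial>lborel) = integral UNIV (\<lambda>x. g_dens \<alpha> w x * f x)"
    by (rule integral_lborel[symmetric])
  finally show ?thesis
    using change_of_variables(2)[OF int] by simp
qed

end

section \<open>Integrals against empirical measures\<close>

lemma integral_Icc_eq_Ico:
  fixes f :: "real \<Rightarrow> 'a::banach"
  shows "integral {a..b} f = integral {a..<b} f"
  unfolding integral_def integrable_on_def has_integral_Icc_iff_Ico ..

lemma integral_emp_measure:
  fixes f :: "real \<Rightarrow> real"
  assumes "0 < n"
  shows "(\<integral>y. f y \<partial>emp_measure n x) = (\<Sum>j=1..n. f (x j)) / n"
proof -
  have "emp_measure n x = measure_pmf (map_pmf x (pmf_of_set {1..n}))"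
    using assms by (simp add: emp_measure_def map_pmf_of_set)
  then show ?thesis
    using assms by (simp add: integral_pmf_of_set)
qed

text \<open>This is why averaging over permutations does not affect the distance to the limit: a
  permutation only reorders the atoms.\<close>

lemma emp_measure_permute:
  assumes "\<pi> permutes {1..n}"
  shows "emp_measure n (\<lambda>j\<in>{1..n}. x (\<pi> j)) = emp_measure n x"
proof -
  have "image_mset (\<lambda>j\<in>{1..n}. x (\<pi> j)) (mset_set {1..n}) = image_mset x (image_mset \<pi> (mset_set {1..n}))"
    unfolding multiset.map_comp by (intro image_mset_cong) simp
  also have "image_mset \<pi> (mset_set {1..n}) = mset_set {1..n}"
    using assms by (simp add: image_mset_mset_set permutes_inj_on permutes_image)
  finally show ?thesis
    by (simp only: emp_measure_def)
qed

section \<open>Deterministic estimate of the distance \<open>W1\<close>\<close>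

context limit_profile
begin

text \<open>A 1-Lipschitz function grows at most linearly, so
  \<open>\<bar>f 0\<bar> + \<phi> t\<close> dominates, and \<phi> is integrable because the limit
  law has finite mean.\<close>

lemma phi_comp_integrable:
  fixes f :: "real \<Rightarrow> real"
  assumes f: "lipschitz_on 1 UNIV f"
  shows "(\<lambda>t. f (\<phi> t)) absolutely_integrable_on {0..<1}"
proof (rule measurable_bounded_by_integrable_imp_absolutely_integrable)
  have "continuous_on {0..<1} (\<lambda>t. f (\<phi> t))"
    by (rule continuous_on_compose2[OF lipschitz_on_continuous_on[OF f] phi_cont]) simp
  then show "(\<lambda>t. f (\<phi> t)) \<in> borel_measurable (lebesgue_on {0..<1})"
    by (rule continuous_imp_measurable_on_sets_lebesgue) simp
  have "(\<lambda>t::real. \<bar>f 0\<bar>) integrable_on {0..<1}"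
    using has_integral_const_real[of "\<bar>f 0\<bar>" 0 1] by (auto simp: has_integral_Icc_iff_Ico)
  then show "(\<lambda>t. \<bar>f 0\<bar> + \<phi> t) integrable_on {0..<1}"
    using phi_integral(1) by (intro integrable_add) (auto simp: absolutely_integrable_on_def)
  fix t :: real assume t: "t \<in> {0..<1}"
  have "\<bar>f (\<phi> t) - f 0\<bar> \<le> \<phi> t"
    using lipschitz_onD[OF f, of "\<phi> t" 0] phi_nonneg[OF t] by (simp add: dist_real_def)
  then show "norm (f (\<phi> t)) \<le> \<bar>f 0\<bar> + \<phi> t"
    by simp
qed simp

lemma phi_comp_integrable_on:
  fixes f :: "real \<Rightarrow> real"
  assumes "lipschitz_on 1 UNIV f" "0 \<le> a" "b \<le> 1"
  shows "(\<lambda>t. f (\<phi> t)) integrable_on {a..b}"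
proof -
  have "(\<lambda>t. f (\<phi> t)) integrable_on {0..1}"
    using phi_comp_integrable[OF assms(1)]
    by (auto simp: absolutely_integrable_on_def integrable_on_def has_integral_Icc_iff_Ico)
  then show ?thesis
    by (rule integrable_on_subinterval) (use assms in auto)
qed

text \<open>On the cell from \<open>(j - 1) / n\<close> to \<open>j / n\<close> monotonicity bounds
  the variation of \<phi> by its increment. The increments telescope to
  \<open>\<phi> (k / n)\<close> since \<open>\<phi> 0 = 0\<close>, and each cell has length
  \<open>1 / n\<close>. The induction adds one cell at a time.\<close>

lemma lipschitz_riemann_sum:
  fixes f :: "real \<Rightarrow> real" and k n :: nat
  assumes f: "lipschitz_on 1 UNIV f" and "0 < n" "k < n"
  shows "\<bar>(\<Sum>j=1..k. f (x j)) / n - integral {0..k / n} (\<lambda>t. f (\<phi> t))\<bar>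
    \<le> (\<Sum>j=1..k. \<bar>x j - \<phi> (j / n)\<bar>) / n + \<phi> (k / n) / n"
  using \<open>k < n\<close>
proof (induction k)
  case 0
  then show ?case by (simp add: phi_0)
next
  case (Suc k)
  let ?u = "\<lambda>t. f (\<phi> t)" and ?s = "real k / n" and ?t = "real (Suc k) / n"
  have st: "0 \<le> ?s" "?s \<le> ?t" "?t < 1" "?t - ?s = 1 / n"
    using Suc.prems by (auto simp: divide_simps)
  have int: "?u integrable_on {?s..?t}"
    using st by (intro phi_comp_integrable_on[OF f]) auto
  have comb: "integral {0..?s} ?u + integral {?s..?t} ?u = integral {0..?t} ?u"
    using st by (intro Henstock_Kurzweil_Integration.integral_combine phi_comp_integrable_on[OF f]) auto
  have has_int: "((\<lambda>t. f (x (Suc k)) - ?u t) has_integral (f (x (Suc k)) / n - integral {?s..?t} ?u)) {?s..?t}"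
    using has_integral_diff[OF has_integral_const_real[of "f (x (Suc k))" ?s ?t] integrable_integral[OF int]] st
    by simp
  have "\<bar>f (x (Suc k)) / n - integral {?s..?t} ?u\<bar>
      \<le> (\<bar>x (Suc k) - \<phi> ?t\<bar> + (\<phi> ?t - \<phi> ?s)) * measure lborel {?s..?t}"
    unfolding real_norm_def[symmetric]
  proof (rule has_integral_bound_real[OF _ finite.emptyI has_int])
    show "0 \<le> norm (x (Suc k) - \<phi> ?t) + (\<phi> ?t - \<phi> ?s)"
      using phi_mono[OF st(1-3)] by simp
    fix t assume "t \<in> {?s..?t} - {}"
    then have t: "t \<in> {?s..?t}" by simp
    have "norm (f (x (Suc k)) - ?u t) \<le> \<bar>x (Suc k) - \<phi> t\<bar>"
      using lipschitz_onD[OF f, of "x (Suc k)" "\<phi> t"] by (simp add: dist_real_def)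
    also have "\<dots> \<le> \<bar>x (Suc k) - \<phi> ?t\<bar> + (\<phi> ?t - \<phi> ?s)"
    proof -
      have "\<phi> ?s \<le> \<phi> t" "\<phi> t \<le> \<phi> ?t"
        using t st by (auto intro!: phi_mono intro: order_trans[OF st(1)])
      then show ?thesis by linarith
    qed
    finally show "norm (f (x (Suc k)) - ?u t) \<le> norm (x (Suc k) - \<phi> ?t) + (\<phi> ?t - \<phi> ?s)"
      by simp
  qed
  also have "\<dots> = \<bar>x (Suc k) - \<phi> ?t\<bar> / n + \<phi> ?t / n - \<phi> ?s / n"
  proof -
    have "measure lborel {?s..?t} = 1 / n"
      using st by simp
    then show ?thesis
      by (simp add: add_divide_distrib diff_divide_distrib del: of_nat_Suc)
  qed
  finally show ?case
    using Suc comb by (simp add: add_divide_distrib del: of_nat_Suc)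
qed

text \<open>With \<open>?B\<close> the Riemann sum bound and \<open>?I\<close> the integral of
  \<phi> up to \<open>m / n\<close>, the head costs \<open>?B\<close>. Both measures having mean 1,
  the tail of the limit costs at most \<open>1 - ?I\<close> and the tail of the empirical measure at
  most \<open>?B + 1 - ?I\<close>.\<close>

lemma W1_emp_measure_le:
  fixes x :: "nat \<Rightarrow> real" and m n :: nat
  assumes mn: "m < n" and x: "\<And>j. j \<in> {1..n} \<Longrightarrow> 0 \<le> x j" "(\<Sum>j=1..n. x j) = n"
  shows "W1 (emp_measure n x) (g_measure \<alpha> w)
    \<le> ereal (2 * ((\<Sum>j=1..m. \<bar>x j - \<phi> (j / n)\<bar>) / n + \<phi> (m / n) / n) + 2 * (1 - integral {0..m / n} \<phi>))"
    (is "_ \<le> ereal (2 * ?B + 2 * (1 - ?I))")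
  unfolding W1_def
proof (intro SUP_least, clarify, unfold ereal_less_eq)
  fix f :: "real \<Rightarrow> real" assume f: "lipschitz_on 1 UNIV f"
  \<comment> \<open>Both measures have total mass 1, so subtracting \<open>f 0\<close> leaves the
    difference of the integrals unchanged while making \<open>u\<close> bounded by the identity on
    the half-line.\<close>
  define u where "u y = f y - f 0" for y
  have u: "lipschitz_on 1 UNIV u"
    using f by (simp add: lipschitz_on_def u_def dist_real_def)
  have u_le: "\<bar>u y\<bar> \<le> y" if "0 \<le> y" for y
    using lipschitz_onD[OF f, of y 0] that by (simp add: u_def dist_real_def)
  have n: "0 < n"
    using mn by simp
  have c: "0 \<le> real m / n" "real m / n < 1"
    using mn by auto
  have id: "lipschitz_on 1 UNIV (\<lambda>y::real. y)"
    by (simp add: lipschitz_on_def)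
  have split: "(\<Sum>j=1..n. F j) = (\<Sum>j=1..m. F j) + (\<Sum>j=m+1..n. F j)" for F :: "nat \<Rightarrow> real"
    using mn by (subst sum.union_disjoint[symmetric]) (auto intro!: sum.cong)
  have comb: "integral {0..<1} (\<lambda>t. F (\<phi> t)) = integral {0..m / n} (\<lambda>t. F (\<phi> t)) + integral {m / n..<1} (\<lambda>t. F (\<phi> t))"
    if "lipschitz_on 1 UNIV F" for F :: "real \<Rightarrow> real"
    unfolding integral_Icc_eq_Ico[symmetric] using c that
    by (intro Henstock_Kurzweil_Integration.integral_combine[symmetric] phi_comp_integrable_on) auto
  have "(\<integral>y. f y \<partial>emp_measure n x) - f 0 = (\<Sum>j=1..n. u (x j)) / n"
    using n by (simp add: integral_emp_measure u_def sum_subtractf field_simps)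
  moreover have "(\<integral>y. f y \<partial>g_measure \<alpha> w) - f 0 = integral {0..<1} (\<lambda>t. u (\<phi> t))"
  proof -
    have "((\<lambda>t. f 0) has_integral f 0) {0..<1::real}"
      using has_integral_const_real[of "f 0" 0 1] by (simp add: has_integral_Icc_iff_Ico)
    then show ?thesis
      using integral_g_measure[OF lipschitz_on_continuous_on[OF f] phi_comp_integrable[OF f]]
        phi_comp_integrable[OF f]
      by (auto simp: u_def absolutely_integrable_on_def has_integral_iff integral_diff)
  qed
  moreover have "\<bar>(\<Sum>j=1..m. u (x j)) / n - integral {0..m / n} (\<lambda>t. u (\<phi> t))\<bar> \<le> ?B"
    by (rule lipschitz_riemann_sum[OF u n mn])
  moreover have "\<bar>(\<Sum>j=m+1..n. u (x j)) / n\<bar> \<le> ?B + 1 - ?I"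
  proof -
    have "\<bar>\<Sum>j=m+1..n. u (x j)\<bar> \<le> (\<Sum>j=m+1..n. x j)"
      using x u_le by (intro order_trans[OF sum_abs] sum_mono) auto
    then have "\<bar>(\<Sum>j=m+1..n. u (x j)) / n\<bar> \<le> (\<Sum>j=m+1..n. x j) / n"
      using n by (simp add: divide_right_mono)
    also have "\<dots> = 1 - (\<Sum>j=1..m. x j) / n"
      using split[of x] x(2) n by (simp add: field_simps)
    also have "\<dots> \<le> ?B + 1 - ?I"
      \<comment> \<open>The same Riemann sum bound, now for the identity, bounds the first moment of
        the head from below.\<close>
      using lipschitz_riemann_sum[OF id n mn, of x] by linarith
    finally show ?thesis .
  qed
  moreover have "\<bar>integral {m / n..<1} (\<lambda>t. u (\<phi> t))\<bar> \<le> 1 - ?I"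
  proof -
    have int: "(\<lambda>t. F (\<phi> t)) integrable_on {m / n..<1}" if "lipschitz_on 1 UNIV F" for F :: "real \<Rightarrow> real"
      using phi_comp_integrable_on[OF that c(1), of 1]
      by (simp add: integrable_on_def has_integral_Icc_iff_Ico)
    have "norm (integral {m / n..<1} (\<lambda>t. u (\<phi> t))) \<le> integral {m / n..<1} \<phi>"
      using int[OF u] int[OF id] c
      by (intro integral_norm_bound_integral) (auto intro!: u_le phi_nonneg intro: order_trans[OF c(1)])
    then show ?thesis
      using comb[OF id] phi_integral(2) by simp
  qed
  \<comment> \<open>The bookkeeping is isolated for abstract reals: \<open>r\<close> is
    \<open>f 0\<close>, the index 1 marks heads and the index 2 tails, \<open>b\<close> is
    \<open>?B\<close> and \<open>i\<close> is \<open>?I\<close>.\<close>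
  moreover have "\<bar>p - q\<bar> \<le> 2 * b + 2 * (1 - i)"
    if "p - r = p1 + p2" "q - r = q1 + q2" "\<bar>p1 - q1\<bar> \<le> b" "\<bar>p2\<bar> \<le> b + 1 - i" "\<bar>q2\<bar> \<le> 1 - i"
    for p q r p1 p2 q1 q2 b i :: real
    using that by (smt (verit))
  ultimately show "\<bar>(\<integral>y. f y \<partial>emp_measure n x) - (\<integral>y. f y \<partial>g_measure \<alpha> w)\<bar> \<le> 2 * ?B + 2 * (1 - ?I)"
    unfolding split comb[OF u] add_divide_distrib[of "sum _ _" "sum _ _"] by blast
qed

lemma phi_tail_small:
  assumes "0 < e"
  obtains s where "0 < s" "s < 1" "\<And>t. s \<le> t \<Longrightarrow> t < 1 \<Longrightarrow> 1 - integral {0..t} \<phi> < e"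
proof -
  have id: "lipschitz_on 1 UNIV (\<lambda>y::real. y)"
    by (simp add: lipschitz_on_def)
  have "continuous_on {0..1} (\<lambda>x. integral {0..x} \<phi>)"
    using phi_comp_integrable_on[OF id, of 0 1] by (intro indefinite_integral_continuous_1) simp
  then have "((\<lambda>x. integral {0..x} \<phi>) \<longlongrightarrow> integral {0..1} \<phi>) (at_left 1)"
    by (auto simp: continuous_on at_within_Icc_at_left dest!: bspec[of _ _ 1])
  then have "\<forall>\<^sub>F x in at_left 1. 1 - e < integral {0..x} \<phi>"
    using assms phi_integral(2) by (intro order_tendstoD) (auto simp: integral_Icc_eq_Ico)
  then obtain b where b: "b < 1" "\<And>y. b < y \<Longrightarrow> y < 1 \<Longrightarrow> 1 - e < integral {0..y} \<phi>"
    by (auto simp: eventually_at_left[of 0 "1::real"])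
  show ?thesis
    \<comment> \<open>The estimate holds strictly beyond \<open>b\<close>, hence the midpoint of
      \<open>b\<close> and 1; the maximum with \<open>1/2\<close> ensures positivity, as
      \<open>b\<close> may be negative.\<close>
    by (rule that[of "max (1/2) ((b + 1) / 2)"]) (use b in \<open>force simp: max_def field_simps split: if_splits\<close>)+
qed

end

section \<open>Uniform Riemann sums and second moments of affine combinations\<close>

text \<open>By uniform continuity each cell costs at most \<open>e / n\<close>, and at most
  \<open>n\<close> cells are summed since \<open>b \<le> 1\<close>. One threshold for
  \<open>n\<close> serves all \<open>k\<close>, as all coordinates are compared with the limit
  simultaneously.\<close>

lemma riemann_sum_uniform:
  fixes f :: "real \<Rightarrow> real"
  assumes f: "continuous_on {0..b} f" and b: "b \<le> 1" and e: "0 < e"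
  shows "\<forall>\<^sub>F n in sequentially. \<forall>k::nat. real k / n \<le> b \<longrightarrow>
    \<bar>(\<Sum>i=1..k. f (i / n)) / n - integral {0..k / n} f\<bar> \<le> e"
proof -
  have "uniformly_continuous_on {0..b} f"
    using f by (rule compact_uniformly_continuous) simp
  then obtain d where d: "0 < d"
    "\<And>s t. s \<in> {0..b} \<Longrightarrow> t \<in> {0..b} \<Longrightarrow> dist t s < d \<Longrightarrow> dist (f t) (f s) < e"
    using e unfolding uniformly_continuous_on_def by metis
  have "\<forall>\<^sub>F n in sequentially. 1 / real n < d"
    using d(1) by (rule order_tendstoD(2)[OF lim_1_over_n])
  with eventually_gt_at_top[of 0] show ?thesis
  proof eventually_elim
    case (elim n)
    have "\<bar>(\<Sum>i=1..k. f (i / n)) / n - integral {0..k / n} f\<bar> \<le> k * (e / n)"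
      if "real k / n \<le> b" for k :: nat
      using that
    proof (induction k)
      case (Suc k)
      let ?s = "real k / n" and ?t = "real (Suc k) / n"
      have st: "0 \<le> ?s" "?s \<le> ?t" "?t - ?s = 1 / n"
        by (simp_all add: divide_right_mono add_divide_distrib)
      have int: "f integrable_on {c..d}" if "0 \<le> c" "d \<le> b" for c d
        by (rule integrable_continuous_real, rule continuous_on_subset[OF f]) (use that in auto)
      have comb: "integral {0..?s} f + integral {?s..?t} f = integral {0..?t} f"
        using st(1,2) int[of 0 ?t] Suc.prems
        by (intro Henstock_Kurzweil_Integration.integral_combine) auto
      have has_int: "((\<lambda>t. f ?t - f t) has_integral (f ?t / n - integral {?s..?t} f)) {?s..?t}"
        using has_integral_diff[OF has_integral_const_real[of "f ?t" ?s ?t] integrable_integral[OF int]]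
          st Suc.prems by simp
      have "\<bar>f ?t / n - integral {?s..?t} f\<bar> \<le> e * measure lborel {?s..?t}"
        unfolding real_norm_def[symmetric]
      proof (rule has_integral_bound_real[OF _ finite.emptyI has_int])
        fix t assume "t \<in> {?s..?t} - {}"
        then have "t \<in> {0..b}" "?t \<in> {0..b}" "dist ?t t < d"
          using st elim Suc.prems by (auto simp: dist_real_def intro: order_trans[OF st(1)])
        then show "norm (f ?t - f t) \<le> e"
          using d(2)[of t ?t] by (simp add: dist_real_def)
      qed (use e in simp)
      also have "\<dots> = e / n"
        using st by simp
      finally have step: "\<bar>f ?t / n - integral {?s..?t} f\<bar> \<le> e / n" .
      have "\<bar>(\<Sum>i=1..k. f (i / n)) / n - integral {0..?s} f\<bar> \<le> k * (e / n)"
        using order_trans[OF st(2) Suc.prems] Suc.IH by blast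
      moreover have "(\<Sum>i=1..Suc k. f (i / n)) / n = (\<Sum>i=1..k. f (i / n)) / n + f ?t / n"
        by (simp add: add_divide_distrib del: of_nat_Suc)
      moreover have "Suc k * (e / n) = k * (e / n) + e / n"
        by (simp add: algebra_simps add_divide_distrib)
      ultimately show ?case
        using step comb by linarith
    qed simp
    moreover have "k * (e / n) \<le> e" if "real k / n \<le> b" for k :: nat
      using that b e mult_right_mono[of "real k / n" 1 e] by simp
    ultimately show ?case
      by (meson order_trans)
  qed
qed

text \<open>Decomposition of a mean square into variance and squared bias. After centering, the
  cross term is linear in the centered coordinates and integrates to 0.\<close>

lemma second_moment_affine:
  fixes M :: "(nat \<Rightarrow> real) measure" and c :: "nat \<Rightarrow> real"
  assumes "prob_space M"
    and int: "\<And>i. i \<in> I \<Longrightarrow> integrable M (\<lambda>z. z i)"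
    and int2: "\<And>i k. i \<in> I \<Longrightarrow> k \<in> I \<Longrightarrow> integrable M (\<lambda>z. z i * z k)"
  shows "integrable M (\<lambda>z. ((\<Sum>i\<in>I. c i * z i) + d)\<^sup>2)"
    "(\<integral>z. ((\<Sum>i\<in>I. c i * z i) + d)\<^sup>2 \<partial>M) =
      (\<Sum>i\<in>I. \<Sum>k\<in>I. c i * c k * coord_cov M i k) + ((\<Sum>i\<in>I. c i * coord_mean M i) + d)\<^sup>2"
proof -
  interpret prob_space M by fact
  let ?m = "coord_mean M"
  define b where "b = (\<Sum>i\<in>I. c i * ?m i) + d"
  have int2': "integrable M (\<lambda>z. (z i - ?m i) * (z k - ?m k))" if "i \<in> I" "k \<in> I" for i k
    using int int2 that by (simp add: algebra_simps)
  have expand: "((\<Sum>i\<in>I. c i * z i) + d)\<^sup>2 =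
      (\<Sum>i\<in>I. \<Sum>k\<in>I. c i * c k * ((z i - ?m i) * (z k - ?m k)))
      + 2 * b * (\<Sum>i\<in>I. c i * (z i - ?m i)) + b\<^sup>2" for z
  proof -
    have "(\<Sum>i\<in>I. c i * z i) + d = (\<Sum>i\<in>I. c i * (z i - ?m i)) + b"
      by (simp add: b_def sum_subtractf algebra_simps)
    moreover have "(\<Sum>i\<in>I. c i * (z i - ?m i))\<^sup>2 =
        (\<Sum>i\<in>I. \<Sum>k\<in>I. c i * c k * ((z i - ?m i) * (z k - ?m k)))"
      unfolding power2_eq_square sum_product by (intro sum.cong refl) (simp only: mult_ac)
    ultimately show ?thesis
      by (simp add: power2_sum)
  qed
  show "integrable M (\<lambda>z. ((\<Sum>i\<in>I. c i * z i) + d)\<^sup>2)"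
    unfolding expand using int int2'
    by (intro Bochner_Integration.integrable_add Bochner_Integration.integrable_sum
        integrable_mult_right Bochner_Integration.integrable_diff integrable_const)
  have "(\<integral>z. z i - ?m i \<partial>M) = 0" if "i \<in> I" for i
    using int[OF that] by (simp add: coord_mean_def prob_space)
  then have "(\<integral>z. (\<Sum>i\<in>I. c i * (z i - ?m i)) \<partial>M) = 0"
    using int by (subst Bochner_Integration.integral_sum) auto
  moreover have "(\<integral>z. (\<Sum>i\<in>I. \<Sum>k\<in>I. c i * c k * ((z i - ?m i) * (z k - ?m k))) \<partial>M) =
      (\<Sum>i\<in>I. \<Sum>k\<in>I. c i * c k * coord_cov M i k)"
    using int2' unfolding coord_cov_def
    by (simp add: Bochner_Integration.integral_sum Bochner_Integration.integrable_sum)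
  moreover have "integrable M (\<lambda>z. \<Sum>i\<in>I. \<Sum>k\<in>I. c i * c k * ((z i - ?m i) * (z k - ?m k)))"
    "integrable M (\<lambda>z. \<Sum>i\<in>I. c i * (z i - ?m i))"
    using int int2' by (auto intro!: Bochner_Integration.integrable_sum)
  ultimately show "(\<integral>z. ((\<Sum>i\<in>I. c i * z i) + d)\<^sup>2 \<partial>M) =
      (\<Sum>i\<in>I. \<Sum>k\<in>I. c i * c k * coord_cov M i k) + ((\<Sum>i\<in>I. c i * coord_mean M i) + d)\<^sup>2"
    unfolding expand by (simp add: prob_space b_def)
qed

section \<open>The map \<open>T_map\<close> and averaging over permutations\<close>

lemma T_map_measurable [measurable]:
  "T_map b n \<in> measurable (PiM {1..n} (\<lambda>_. borel)) (PiM {1..n} (\<lambda>_. borel))"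
  unfolding T_map_def[abs_def]
proof (rule measurable_restrict)
  fix j assume "j \<in> {1..n}"
  then have "(\<lambda>z. z i) \<in> borel_measurable (PiM {1..n} (\<lambda>_. borel :: real measure))" if "i \<in> {1..j}" for i
    using that by (intro measurable_component_singleton) auto
  then show "(\<lambda>z. n * (1 - b / 2) * (\<Sum>i=1..j. z i / real (n + 1 - i)) + (real j - 1) / (real n - 1) * b)
      \<in> borel_measurable (PiM {1..n} (\<lambda>_. borel))"
    by (intro borel_measurable_add borel_measurable_times borel_measurable_sum borel_measurable_divide
        borel_measurable_const)
qed

lemma T_map_nonneg:
  assumes "z \<in> std_simplex n" "0 < b" "b < 2" "j \<in> {1..n}"
  shows "0 \<le> T_map b n z j"
  using assms unfolding T_map_def std_simplex_def
  by (auto intro!: add_nonneg_nonneg mult_nonneg_nonneg sum_nonneg divide_nonneg_nonneg)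

text \<open>The term \<open>z i / real (n + 1 - i)\<close> enters exactly the
  \<open>n + 1 - i\<close> coordinates from \<open>i\<close> to \<open>n\<close>, so the double sum
  collapses to \<open>\<Sum>i=1..n. z i\<close>, which is 1. The arithmetic progression adds
  \<open>n * b / 2\<close>, which compensates the factor \<open>1 - b / 2\<close>. Hence every
  empirical measure has mean 1.\<close>

lemma sum_T_map:
  assumes z: "z \<in> std_simplex n" and n: "2 \<le> n"
  shows "(\<Sum>j=1..n. T_map b n z j) = n"
proof -
  have "(\<Sum>j=1..n. \<Sum>i=1..j. z i / real (n + 1 - i)) = (\<Sum>j=1..n. \<Sum>i\<in>{i\<in>{1..n}. i \<le> j}. z i / real (n + 1 - i))"
    by (intro sum.cong) auto
  also have "\<dots> = (\<Sum>i=1..n. \<Sum>j\<in>{j\<in>{1..n}. i \<le> j}. z i / real (n + 1 - i))"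
    by (rule sum.swap_restrict) auto
  also have "\<dots> = (\<Sum>i=1..n. z i)"
  proof (intro sum.cong refl)
    fix i assume i: "i \<in> {1..n}"
    then have "{j\<in>{1..n}. i \<le> j} = {i..n}"
      by auto
    then show "(\<Sum>j\<in>{j\<in>{1..n}. i \<le> j}. z i / real (n + 1 - i)) = z i"
      using i by simp
  qed
  also have "\<dots> = 1"
    using z by (simp add: std_simplex_def)
  finally have 1: "(\<Sum>j=1..n. \<Sum>i=1..j. z i / real (n + 1 - i)) = 1" .
  have "(\<Sum>j=1..k. real j - 1) = k * (real k - 1) / 2" for k
    by (induction k) (auto simp: field_simps)
  then have 2: "(\<Sum>j=1..n. (real j - 1) / (real n - 1)) = n / 2"
    using n by (simp add: sum_divide_distrib[symmetric])
  have "(\<Sum>j=1..n. T_map b n z j) = n * (1 - b / 2) * (\<Sum>j=1..n. \<Sum>i=1..j. z i / real (n + 1 - i))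
      + (\<Sum>j=1..n. (real j - 1) / (real n - 1)) * b"
    by (simp add: T_map_def sum.distrib sum_distrib_left sum_distrib_right)
  also have "\<dots> = n"
    unfolding 1 2 by (simp add: field_simps)
  finally show ?thesis .
qed

text \<open>A good set \<open>G\<close> of ordered configurations is not invariant under permutations, so \<open>A\<close> is the
  complement of its orbit.\<close>

lemma hat_tau_cover:
  assumes M: "prob_space (\<tau> n)" "sets (\<tau> n) = sets (PiM {1..n} (\<lambda>_. borel))"
    and G: "G \<in> sets (PiM {1..n} (\<lambda>_. borel))"
  shows "\<exists>A\<in>sets (hat_tau \<tau> a n).
    (\<forall>x\<in>space (hat_tau \<tau> a n) - A. \<exists>\<pi>. \<pi> permutes {1..n} \<and> (\<lambda>j\<in>{1..n}. x (\<pi> j)) \<in> G) \<and>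
    measure (hat_tau \<tau> a n) A \<le> measure (\<tau> n) {z \<in> space (\<tau> n). T_map (a n) n z \<notin> G}"
proof -
  let ?P = "PiM {1..n} (\<lambda>_. borel :: real measure)" and ?S = "{\<pi>. \<pi> permutes {1..n}}"
  let ?perm = "\<lambda>\<pi> x. \<lambda>j\<in>{1..n}. x (\<pi> j)"
  let ?Q = "\<tau> n \<Otimes>\<^sub>M measure_pmf (perms_pmf n)"
  let ?F = "\<lambda>(z, \<pi>). ?perm \<pi> (T_map (a n) n z)"
  let ?Z = "{z \<in> space (\<tau> n). T_map (a n) n z \<notin> G}"
  define A where "A = space ?P - (\<Union>\<pi>\<in>?S. {x \<in> space ?P. ?perm \<pi> x \<in> G})"
  interpret \<tau>: prob_space "\<tau> n" by (rule M)
  interpret Q: pair_prob_space "\<tau> n" "measure_pmf (perms_pmf n)" ..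
  have sp: "space (\<tau> n) = space ?P"
    using M(2) by (rule sets_eq_imp_space_eq)
  have T: "T_map (a n) n \<in> measurable (\<tau> n) ?P"
    using T_map_measurable M(2) by (simp cong: measurable_cong_sets)
  have sets: "sets (hat_tau \<tau> a n) = sets ?P" "space (hat_tau \<tau> a n) = space ?P"
    by (simp_all add: hat_tau_def)
  have perm: "?perm \<pi> \<in> measurable ?P ?P" if "\<pi> \<in> ?S" for \<pi>
    using that by (intro measurable_restrict measurable_component_singleton) (simp only: permutes_in_image mem_Collect_eq)
  have F: "?F \<in> measurable ?Q ?P"
    unfolding case_prod_beta
  proof (rule measurable_restrict)
    fix j assume "j \<in> {1..n}"
    show "(\<lambda>p. T_map (a n) n (fst p) (snd p j)) \<in> borel_measurable ?Q"
    \<comment> \<open>The coordinate is selected by a random index, so measurability is checked for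
      each of the countably many values of that index.\<close>
    proof (rule measurable_compose_countable[where g="\<lambda>p. snd p j"])
      show "(\<lambda>p. T_map (a n) n (fst p) i) \<in> borel_measurable ?Q" for i
      proof (cases "i \<in> {1..n}")
        case True
        then show ?thesis
          by (intro measurable_compose[OF measurable_fst measurable_compose[OF T]]
              measurable_component_singleton)
      next
        \<comment> \<open>The second component ranges over all functions, not only permutations, so
          an index outside \<open>{1..n}\<close> can occur; there \<open>T_map\<close> is constantly
          \<open>undefined\<close>.\<close>
        case False
        then have "T_map (a n) n z i = undefined" for z
          unfolding T_map_def by (simp only: restrict_def if_False)
        then show ?thesis
          by simp
      qed
      show "(\<lambda>p. snd p j) \<in> measurable ?Q (count_space UNIV)"
        by (intro measurable_compose[OF measurable_snd]) simp
    qed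
  qed
  have fin: "finite ?S"
    by (rule finite_permutations) simp
  have A: "A \<in> sets ?P"
    unfolding A_def using fin measurable_sets[OF perm G]
    by (intro sets.Diff sets.finite_UN) (auto simp: vimage_def Int_def conj_commute)
  then have A': "A \<in> sets (hat_tau \<tau> a n)"
    by (simp add: sets)
  have cover: "\<exists>\<pi>. \<pi> permutes {1..n} \<and> ?perm \<pi> x \<in> G" if "x \<in> space (hat_tau \<tau> a n) - A" for x
    using that by (auto simp: sets A_def)
  have Z: "?Z \<in> sets (\<tau> n)"
    using measurable_sets[OF T, of "space ?P - G"] G measurable_space[OF T]
    by (auto simp: vimage_def Int_def conj_commute cong: conj_cong elim!: back_subst[of "\<lambda>S. S \<in> _"])
  \<comment> \<open>A pair is sent into \<open>A\<close> only if \<open>z\<close> is bad or the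
    second component is not a permutation; the latter has probability 0.\<close>
  have "?F -` A \<inter> space ?Q \<subseteq> ?Z \<times> UNIV \<union> space (\<tau> n) \<times> (- ?S)"
  proof (rule subsetI, rule ccontr)
    fix p assume p: "p \<in> ?F -` A \<inter> space ?Q" "p \<notin> ?Z \<times> UNIV \<union> space (\<tau> n) \<times> (- ?S)"
    obtain z \<pi> where p_eq: "p = (z, \<pi>)"
      by fastforce
    have z: "z \<in> space (\<tau> n)" "?perm \<pi> (T_map (a n) n z) \<in> A" and \<pi>: "\<pi> permutes {1..n}"
      and "T_map (a n) n z \<in> G"
      using p unfolding p_eq space_pair_measure by auto
    \<comment> \<open>The inverse permutation undoes the shuffle, so a shuffled good configuration
      has a good member in its orbit.\<close>
    have "?perm (inv \<pi>) (?perm \<pi> (T_map (a n) n z)) = T_map (a n) n z"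
      using \<pi> permutes_in_image[OF permutes_inv[OF \<pi>]]
      by (auto simp: fun_eq_iff permutes_inverses T_map_def)
    moreover have "inv \<pi> permutes {1..n}"
      using \<pi> by (simp add: permutes_inv)
    ultimately show False
      using z \<open>T_map (a n) n z \<in> G\<close> unfolding A_def by force
  qed
  then have "measure ?Q (?F -` A \<inter> space ?Q) \<le> measure ?Q (?Z \<times> UNIV \<union> space (\<tau> n) \<times> (- ?S))"
    using Z by (intro Q.finite_measure_mono) auto
  also have "\<dots> \<le> measure ?Q (?Z \<times> UNIV) + measure ?Q (space (\<tau> n) \<times> (- ?S))"
    using Z by (intro measure_Un_le) auto
  also have "measure ?Q (?Z \<times> UNIV) = measure (\<tau> n) ?Z"
    using Z by (simp add: measure_pmf.emeasure_pair_measure_Times measure_def)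
  also have "measure ?Q (space (\<tau> n) \<times> (- ?S)) = 0"
  proof -
    have "?S \<noteq> {}"
      using permutes_id by blast
    then have "emeasure (measure_pmf (perms_pmf n)) (- ?S) = 0"
      using fin by (simp add: perms_pmf_def emeasure_pmf_of_set)
    then show ?thesis
      by (simp add: measure_pmf.emeasure_pair_measure_Times measure_def)
  qed
  finally have "measure (hat_tau \<tau> a n) A \<le> measure (\<tau> n) ?Z"
    unfolding hat_tau_def measure_distr[OF F A] by (simp only: add_0_right)
  with A' cover show ?thesis
    by blast
qed

section \<open>Mean and variance of the transported coordinates\<close>

lemma less_of_less_mult:
  fixes \<xi> :: real and j n :: nat
  assumes "\<xi> < 1" "real j < n * \<xi>"
  shows "j < n"
proof -
  have "real n * \<xi> \<le> real n * 1"
    using assms by (intro mult_left_mono) auto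
  then show ?thesis
    using assms(2) by linarith
qed

locale chaotic_simplices = limit_profile +
  fixes \<tau> :: "nat \<Rightarrow> (nat \<Rightarrow> real) measure" and a :: "nat \<Rightarrow> real"
  assumes tau_prob: "1 \<le> n \<Longrightarrow> prob_space (\<tau> n)"
    and tau_sets: "1 \<le> n \<Longrightarrow> sets (\<tau> n) = sets (PiM {1..n} (\<lambda>_. borel))"
    and tau_simplex: "1 \<le> n \<Longrightarrow> AE z in \<tau> n. z \<in> std_simplex n"
    and tau_chaotic: "pre_chaotic w \<tau>"
    and a_range: "0 < a n" "a n < 2"
    and a_lim: "a \<longlonglongrightarrow> \<alpha>"
begin

text \<open>The quantifier-free core of \<open>pre_chaotic\<close>, split off so that the threshold
  on \<open>n\<close> can be handled by \<open>eventually\<close>.\<close>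

definition chaotic_at :: "real \<Rightarrow> real \<Rightarrow> real \<Rightarrow> nat \<Rightarrow> nat \<Rightarrow> nat \<Rightarrow> bool" where
  "chaotic_at \<xi> C \<epsilon> n j k \<longleftrightarrow>
    1 \<le> j \<and> 1 \<le> k \<and> real j < real n * \<xi> \<and> real k < real n * \<xi> \<longrightarrow>
      \<bar>real n * coord_mean (\<tau> n) j - w (real j / real n)\<bar> < \<epsilon>
      \<and> coord_var (\<tau> n) j \<le> C * \<epsilon> / real n
      \<and> (j \<noteq> k \<longrightarrow> \<bar>coord_cov (\<tau> n) j k\<bar> \<le> C * \<epsilon> / (real n)\<^sup>2)"

text \<open>\<open>C\<close> is quantified before \<open>\<epsilon>\<close>, so
  \<open>\<epsilon>\<close> may later be chosen small relative to \<open>C\<close>.\<close>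

lemma chaotic_bounds:
  assumes "0 < \<xi>" "\<xi> < 1"
  shows "\<exists>C. \<forall>\<epsilon>>0. \<forall>\<^sub>F n in sequentially. \<forall>j k. chaotic_at \<xi> C \<epsilon> n j k"
  using tau_chaotic[unfolded pre_chaotic_def, THEN spec[of _ \<xi>], THEN mp, OF conjI[OF assms]]
  unfolding chaotic_at_def eventually_at_top_dense .

text \<open>Almost surely the coordinates are nonnegative with sum 1, hence lie in the unit
  interval.\<close>

lemma coord_integrable:
  assumes n: "1 \<le> n" and i: "i \<in> {1..n}" "k \<in> {1..n}"
  shows "integrable (\<tau> n) (\<lambda>z. z i)" "integrable (\<tau> n) (\<lambda>z. z i * z k)"
proof -
  interpret prob_space "\<tau> n"
    using n by (rule tau_prob)
  have m: "(\<lambda>z. z l) \<in> borel_measurable (\<tau> n)" if "l \<in> {1..n}" for l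
    using measurable_component_singleton[OF that, of "\<lambda>_. borel"] tau_sets[OF n]
    by (simp cong: measurable_cong_sets)
  have bound: "AE z in \<tau> n. \<bar>z l\<bar> \<le> 1" if "l \<in> {1..n}" for l
    using tau_simplex[OF n]
  proof eventually_elim
    case (elim z)
    then have "\<forall>j\<in>{1..n}. 0 \<le> z j" "(\<Sum>j=1..n. z j) = 1"
      by (auto simp: std_simplex_def)
    with member_le_sum[of l "{1..n}" z] that show ?case
      by auto
  qed
  show "integrable (\<tau> n) (\<lambda>z. z i)"
    using m[OF i(1)] bound[OF i(1)] by (intro integrable_const_bound[where B=1]) auto
  have "AE z in \<tau> n. \<bar>z i * z k\<bar> \<le> 1"
    using bound[OF i(1)] bound[OF i(2)]
    by eventually_elim (auto simp: abs_mult intro: mult_le_one)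
  then show "integrable (\<tau> n) (\<lambda>z. z i * z k)"
    using m[OF i(1)] m[OF i(2)] by (intro integrable_const_bound[where B=1]) auto
qed

definition T_coeff where "T_coeff n i = real n * (1 - a n / 2) / real (n + 1 - i)"

lemma T_map_eq:
  assumes "j \<in> {1..n}"
  shows "T_map (a n) n z j = (\<Sum>i=1..j. T_coeff n i * z i) + (real j - 1) / (real n - 1) * a n"
proof -
  have "(\<Sum>i=1..j. T_coeff n i * z i) = n * (1 - a n / 2) * (\<Sum>i=1..j. z i / real (n + 1 - i))"
    unfolding sum_distrib_left T_coeff_def by (intro sum.cong refl) simp
  then show ?thesis
    using assms by (simp add: T_map_def)
qed

text \<open>The cutoff \<open>\<xi> < 1\<close> enters here: for \<open>i < n * \<xi>\<close> the
  denominator \<open>n + 1 - i\<close> is at least \<open>n * (1 - \<xi>)\<close>.\<close>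

lemma T_coeff_bounds:
  fixes \<xi> :: real
  assumes "\<xi> < 1" "real i < n * \<xi>"
  shows "0 \<le> T_coeff n i" "T_coeff n i \<le> 1 / (1 - \<xi>)"
proof -
  have n: "i < n"
    using assms by (rule less_of_less_mult)
  then have i: "real n * (1 - \<xi>) \<le> real (n + 1 - i)" "0 < real n * (1 - \<xi>)"
    using assms by (auto simp: of_nat_diff algebra_simps)
  show "0 \<le> T_coeff n i"
    using a_range[of n] by (simp add: T_coeff_def)
  have "T_coeff n i \<le> real n * 1 / (real n * (1 - \<xi>))"
    unfolding T_coeff_def using a_range[of n] i by (intro frac_le mult_left_mono) auto
  then show "T_coeff n i \<le> 1 / (1 - \<xi>)"
    using n by simp
qed

lemma h_bounded:
  fixes \<xi> :: real
  assumes "\<xi> < 1"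
  obtains H where "0 \<le> H" "\<And>t. t \<in> {0..\<xi>} \<Longrightarrow> \<bar>h t\<bar> \<le> H"
proof -
  have "bounded (h ` {0..\<xi>})"
    by (intro compact_imp_bounded compact_continuous_image continuous_on_subset[OF h_cont])
       (use assms in auto)
  then show ?thesis
    using that unfolding bounded_pos by (metis image_eqI less_imp_le real_norm_def)
qed

text \<open>The mean of \<open>z i\<close> is about \<open>w (i / n) / n\<close>, and
  \<open>n / (n + 1 - i)\<close> is about \<open>1 / (1 - i / n)\<close>, so the sum of means is
  nearly a Riemann sum for the integral of \<open>h\<close>.\<close>

lemma mean_T_map_close:
  fixes \<xi> :: real
  assumes \<xi>: "0 < \<xi>" "\<xi> < 1" and \<eta>: "0 < \<eta>"
  shows "\<forall>\<^sub>F n in sequentially. \<forall>j::nat. 1 \<le> j \<and> real j < n * \<xi> \<longrightarrow>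
    \<bar>(\<Sum>i=1..j. T_coeff n i * coord_mean (\<tau> n) i) + (real j - 1) / (real n - 1) * a n - \<phi> (j / n)\<bar> \<le> \<eta>"
proof -
  define K where "K = 1 / (1 - \<xi>)"
  have K: "0 < K"
    using \<xi> by (simp add: K_def)
  obtain H where H: "0 \<le> H" "\<And>t. t \<in> {0..\<xi>} \<Longrightarrow> \<bar>h t\<bar> \<le> H"
    using h_bounded[OF \<xi>(2)] by blast
  \<comment> \<open>Replacing the means by \<open>w\<close> costs \<open>e * K\<close>, replacing
    the Riemann sum by the integral costs \<open>e\<close>; together they use up
    \<open>\<eta> / 4\<close>.\<close>
  define e where "e = \<eta> / 4 / (K + 1)"
  have e: "0 < e" "e * K + e = \<eta> / 4"
  proof -
    show "0 < e"
      using \<eta> K by (simp add: e_def)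
    have "K + 1 \<noteq> 0"
      using K by simp
    then have "\<eta> / 4 = e * (K + 1)"
      by (rule nonzero_divide_eq_eq[THEN iffD1]) (rule e_def[symmetric])
    then show "e * K + e = \<eta> / 4"
      by (simp add: distrib_left)
  qed
  obtain C where C: "\<And>\<epsilon>. 0 < \<epsilon> \<Longrightarrow> \<forall>\<^sub>F n in sequentially. \<forall>j k. chaotic_at \<xi> C \<epsilon> n j k"
    using chaotic_bounds[OF \<xi>] by auto
  have mean: "\<forall>\<^sub>F n in sequentially. \<forall>i::nat. 1 \<le> i \<and> real i < n * \<xi> \<longrightarrow>
      \<bar>real n * coord_mean (\<tau> n) i - w (i / n)\<bar> < e"
    using C[OF e(1)] by eventually_elim (auto simp: chaotic_at_def)
  have riemann: "\<forall>\<^sub>F n in sequentially. \<forall>k::nat. real k / n \<le> \<xi> \<longrightarrow>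
      \<bar>(\<Sum>i=1..k. h (i / n)) / n - integral {0..k / n} h\<bar> \<le> e"
    using \<xi> e(1) by (intro riemann_sum_uniform continuous_on_subset[OF h_cont]) auto
  \<comment> \<open>The total of all the errors below; its limit is \<open>\<eta> / 4\<close>, hence
    eventually less than \<eta>.\<close>
  have "(\<lambda>n. \<eta> / 4 + H * K * (1 / n) + \<bar>a n - \<alpha>\<bar> * (H + 1) + 2 * (1 / n))
      \<longlonglongrightarrow> \<eta> / 4 + H * K * 0 + \<bar>\<alpha> - \<alpha>\<bar> * (H + 1) + 2 * 0"
    by (intro tendsto_intros a_lim lim_1_over_n)
  then have small: "\<forall>\<^sub>F n in sequentially.
      \<eta> / 4 + H * K * (1 / n) + \<bar>a n - \<alpha>\<bar> * (H + 1) + 2 * (1 / n) < \<eta>"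
    by (rule order_tendstoD(2)) (use \<eta> in simp)
  show ?thesis
    using mean riemann small eventually_ge_at_top[of 2]
  proof eventually_elim
    case (elim n)
    show ?case
    proof (intro allI impI, elim conjE)
      fix j :: nat assume j: "1 \<le> j" "real j < n * \<xi>"
      have n: "2 \<le> n" by (rule elim(4))
      have jn: "real j / n < \<xi>" "real j \<le> n" "real j / n \<le> 1"
        using j n less_of_less_mult[OF \<xi>(2) j(2)] by (auto simp: divide_simps mult.commute)
      define m where "m i = real n * coord_mean (\<tau> n) i" for i
      define X where "X = (\<Sum>i=1..j. m i / real (n + 1 - i))"
      define I where "I = integral {0..j / n} h"
      have "\<bar>X - (\<Sum>i=1..j. h (i / n)) / n\<bar> \<le> (\<Sum>i=1..j. e * K / n + H * K / n\<^sup>2)"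
      proof -
        have "\<bar>m i / real (n + 1 - i) - h (i / n) / n\<bar> \<le> e * K / n + H * K / n\<^sup>2" if i: "i \<in> {1..j}" for i
        proof -
          have i': "real i < n * \<xi>" "i < n"
            using i j less_of_less_mult[OF \<xi>(2) j(2)] by auto
          have q: "1 / real (n + 1 - i) \<le> K / n"
          proof -
            have "real n * (1 - \<xi>) \<le> real (n + 1 - i)"
              using i' by (simp add: of_nat_diff algebra_simps)
            then have "1 / real (n + 1 - i) \<le> 1 / (real n * (1 - \<xi>))"
              using n \<xi> i' by (intro divide_left_mono mult_pos_pos) auto
            then show ?thesis
              by (simp add: K_def mult.commute)
          qed
          \<comment> \<open>As \<open>h (i / n) / n = w (i / n) / (n - i)\<close>, the shift from
            \<open>n - i\<close> to \<open>n + 1 - i\<close> leaves the second product, which is of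
            order \<open>1 / n\<^sup>2\<close>.\<close>
          have "m i / real (n + 1 - i) - h (i / n) / n =
              (m i - w (i / n)) * (1 / real (n + 1 - i)) - h (i / n) / n * (1 / real (n + 1 - i))"
            using i' n by (simp add: of_nat_diff divide_simps) (simp add: algebra_simps)
          also have "\<bar>\<dots>\<bar> \<le> \<bar>m i - w (i / n)\<bar> * (1 / real (n + 1 - i)) + \<bar>h (i / n)\<bar> / n * (1 / real (n + 1 - i))"
            by (intro order_trans[OF abs_triangle_ineq4]) (simp add: abs_mult)
          also have "\<dots> \<le> e * (K / n) + H / n * (K / n)"
          proof (intro add_mono mult_mono q)
            show "\<bar>m i - w (i / n)\<bar> \<le> e"
              using elim(1) i i' by (auto simp: m_def intro: less_imp_le)
            have "real i / n \<in> {0..\<xi>}"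
              using i' n by (simp add: divide_simps mult.commute)
            then show "\<bar>h (i / n)\<bar> / n \<le> H / n"
              by (intro divide_right_mono H(2)) auto
          qed (use e H in auto)
          finally show ?thesis
            by (simp add: power2_eq_square)
        qed
        then show ?thesis
          unfolding X_def sum_divide_distrib sum_subtractf[symmetric]
          by (intro order_trans[OF sum_abs] sum_mono)
      qed
      also have "\<dots> = real j / n * (e * K + H * K / n)"
        by (simp add: power2_eq_square algebra_simps)
      also have "\<dots> \<le> e * K + H * K / n"
        using jn(3) e(1) K H(1) by (intro mult_left_le_one_le) auto
      finally have X_sum: "\<bar>X - (\<Sum>i=1..j. h (i / n)) / n\<bar> \<le> e * K + H * K / n" .
      have sum_I: "\<bar>(\<Sum>i=1..j. h (i / n)) / n - I\<bar> \<le> e"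
        using elim(2) jn(1) unfolding I_def by simp
      have X_I: "\<bar>X - I\<bar> \<le> \<eta> / 4 + H * K * (1 / n)"
        using X_sum sum_I e(2) by simp
      have "norm I \<le> H * measure lborel {0..real j / n}"
        unfolding I_def
      proof (rule has_integral_bound_real[OF H(1) finite.emptyI integrable_integral])
        show "h integrable_on {0..real j / n}"
          by (rule integrable_continuous_real, rule continuous_on_subset[OF h_cont]) (use jn \<xi> in auto)
        show "norm (h t) \<le> H" if "t \<in> {0..real j / n} - {}" for t
          using H(2)[of t] that jn by simp
      qed
      also have "\<dots> \<le> H"
        using mult_left_le[OF jn(3) H(1)] by simp
      finally have I_H: "\<bar>I\<bar> \<le> H"
        by simp
      define r where "r = (real j - 1) / (real n - 1)"
      have r: "0 \<le> r" "r \<le> 1" "\<bar>r - real j / n\<bar> \<le> 1 / n"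
      proof -
        show "0 \<le> r" "r \<le> 1"
          using j(1) n jn(2) by (auto simp: r_def)
        define q where "q = (real n - j) / (real n - 1)"
        have "real j / n - r = q / n"
          using n by (simp add: r_def q_def divide_simps) (simp add: algebra_simps)
        moreover have "0 \<le> q" "q \<le> 1"
          using j(1) n jn(2) by (auto simp: q_def)
        then have "0 \<le> q / n" "q / n \<le> 1 / n"
          by (auto intro: divide_right_mono)
        ultimately show "\<bar>r - real j / n\<bar> \<le> 1 / n"
          by linarith
      qed
      have sum_eq: "(\<Sum>i=1..j. T_coeff n i * coord_mean (\<tau> n) i) = (1 - a n / 2) * X"
        unfolding X_def sum_distrib_left by (intro sum.cong refl) (simp add: T_coeff_def m_def)
      have phi_eq: "\<phi> (j / n) = (1 - \<alpha> / 2) * I + \<alpha> * (j / n)"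
        by (simp add: phi_def I_def)
      \<comment> \<open>The four terms are the error of the sum, the change from \<open>a n\<close>
        to \<alpha> in the integral part and in the linear part, and the shift from
        \<open>j / n\<close> to \<open>r\<close>.\<close>
      have eq: "(\<Sum>i=1..j. T_coeff n i * coord_mean (\<tau> n) i) + r * a n - \<phi> (j / n) =
          (1 - a n / 2) * (X - I) + (\<alpha> - a n) * (I / 2) + (a n - \<alpha>) * r + \<alpha> * (r - j / n)"
        unfolding sum_eq phi_eq by (simp add: field_simps)
      have bounds: "\<bar>(1 - a n / 2) * (X - I)\<bar> \<le> \<eta> / 4 + H * K * (1 / n)"
        "\<bar>(\<alpha> - a n) * (I / 2)\<bar> \<le> \<bar>a n - \<alpha>\<bar> * H"
        "\<bar>(a n - \<alpha>) * r\<bar> \<le> \<bar>a n - \<alpha>\<bar> * 1"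
        "\<bar>\<alpha> * (r - j / n)\<bar> \<le> 2 * (1 / n)"
      proof -
        have "\<bar>1 - a n / 2\<bar> * \<bar>X - I\<bar> \<le> 1 * (\<eta> / 4 + H * K * (1 / n))"
          using a_range[of n] by (intro mult_mono X_I) auto
        then show "\<bar>(1 - a n / 2) * (X - I)\<bar> \<le> \<eta> / 4 + H * K * (1 / n)"
          by (simp add: abs_mult)
        show "\<bar>(\<alpha> - a n) * (I / 2)\<bar> \<le> \<bar>a n - \<alpha>\<bar> * H"
          unfolding abs_mult abs_minus_commute[of \<alpha>] using I_H by (intro mult_left_mono) auto
        show "\<bar>(a n - \<alpha>) * r\<bar> \<le> \<bar>a n - \<alpha>\<bar> * 1"
          unfolding abs_mult using r by (intro mult_left_mono) auto
        show "\<bar>\<alpha> * (r - j / n)\<bar> \<le> 2 * (1 / n)"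
          unfolding abs_mult using r alpha_pos alpha_less by (intro mult_mono) auto
      qed
      have triangle: "\<bar>x + y + z + u\<bar> \<le> \<bar>x\<bar> + \<bar>y\<bar> + \<bar>z\<bar> + \<bar>u\<bar>" for x y z u :: real
        by linarith
      have "\<bar>(\<Sum>i=1..j. T_coeff n i * coord_mean (\<tau> n) i) + r * a n - \<phi> (j / n)\<bar>
          \<le> \<eta> / 4 + H * K * (1 / n) + \<bar>a n - \<alpha>\<bar> * H + \<bar>a n - \<alpha>\<bar> * 1 + 2 * (1 / n)"
        unfolding eq by (rule order_trans[OF triangle]) (intro add_mono bounds)
      also have "\<dots> = \<eta> / 4 + H * K * (1 / n) + \<bar>a n - \<alpha>\<bar> * (H + 1) + 2 * (1 / n)"
        by (simp add: distrib_left)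
      also have "\<dots> \<le> \<eta>"
        using elim(3) by (rule less_imp_le)
      finally show "\<bar>(\<Sum>i=1..j. T_coeff n i * coord_mean (\<tau> n) i)
          + (real j - 1) / (real n - 1) * a n - \<phi> (j / n)\<bar> \<le> \<eta>"
        unfolding r_def .
    qed
  qed
qed

text \<open>At most \<open>n\<close> variances of order \<open>1 / n\<close> and
  \<open>n\<^sup>2\<close> covariances of order \<open>1 / n\<^sup>2\<close>, all with a small
  constant and bounded weights, give a small variance. The squared bias is small by
  \<open>mean_T_map_close\<close>.\<close>

lemma T_map_second_moment:
  fixes \<xi> :: real
  assumes \<xi>: "0 < \<xi>" "\<xi> < 1" and \<eta>: "0 < \<eta>"
  shows "\<forall>\<^sub>F n in sequentially. \<forall>j::nat. 1 \<le> j \<and> real j < n * \<xi> \<longrightarrow>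
    integrable (\<tau> n) (\<lambda>z. (T_map (a n) n z j - \<phi> (j / n))\<^sup>2) \<and>
    (\<integral>z. (T_map (a n) n z j - \<phi> (j / n))\<^sup>2 \<partial>\<tau> n) \<le> \<eta>"
proof -
  define K where "K = 1 / (1 - \<xi>)"
  have K: "0 < K"
    using \<xi> by (simp add: K_def)
  obtain C where C: "\<And>\<epsilon>. 0 < \<epsilon> \<Longrightarrow> \<forall>\<^sub>F n in sequentially. \<forall>j k. chaotic_at \<xi> C \<epsilon> n j k"
    using chaotic_bounds[OF \<xi>] by auto
  \<comment> \<open>Diagonal and off-diagonal terms contribute at most \<open>K\<^sup>2 * c\<close>
    each, so the variance gets at most \<open>\<eta> / 2\<close>.\<close>
  define c where "c = \<eta> / (4 * K\<^sup>2)"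
  have c: "0 < c"
    using \<eta> K by (simp add: c_def)
  \<comment> \<open>Dividing by \<open>\<bar>C\<bar> + 1\<close> also covers a \<open>C\<close> that
    is zero or negative.\<close>
  define e where "e = c / (\<bar>C\<bar> + 1)"
  have e: "0 < e" "C * e \<le> c"
  proof -
    show "0 < e" using c by (simp add: e_def)
    have "C * c \<le> c * (\<bar>C\<bar> + 1)"
      using c by (simp add: mult.commute[of C] mult_left_mono)
    then show "C * e \<le> c"
      by (simp add: e_def divide_simps)
  qed
  have cov: "\<forall>\<^sub>F n in sequentially. \<forall>i k::nat. 1 \<le> i \<and> 1 \<le> k \<and> real i < n * \<xi> \<and> real k < n * \<xi> \<longrightarrow>
      coord_cov (\<tau> n) i i \<le> C * e / n \<and> (i \<noteq> k \<longrightarrow> \<bar>coord_cov (\<tau> n) i k\<bar> \<le> C * e / n\<^sup>2)"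
    using C[OF e(1)] by eventually_elim (auto simp: chaotic_at_def coord_var_def)
  \<comment> \<open>With this tolerance for the bias, its square takes the other half of
    \<eta>.\<close>
  have "0 < sqrt (\<eta> / 2)"
    using \<eta> by simp
  note mean = mean_T_map_close[OF \<xi> this]
  show ?thesis
    using cov mean eventually_ge_at_top[of 1]
  proof eventually_elim
    case (elim n)
    show ?case
    proof (intro allI impI, elim conjE)
      fix j :: nat assume j: "1 \<le> j" "real j < n * \<xi>"
      define d where "d = (real j - 1) / (real n - 1) * a n - \<phi> (j / n)"
      let ?b = "(\<Sum>i=1..j. T_coeff n i * coord_mean (\<tau> n) i) + d"
      have jn: "j \<in> {1..n}"
        using j less_of_less_mult[OF \<xi>(2) j(2)] by auto
      have T: "T_map (a n) n z j - \<phi> (j / n) = (\<Sum>i=1..j. T_coeff n i * z i) + d" for z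
        unfolding T_map_eq[OF jn] d_def by simp
      have mom: "integrable (\<tau> n) (\<lambda>z. ((\<Sum>i=1..j. T_coeff n i * z i) + d)\<^sup>2)"
        "(\<integral>z. ((\<Sum>i=1..j. T_coeff n i * z i) + d)\<^sup>2 \<partial>\<tau> n) =
          (\<Sum>i=1..j. \<Sum>k=1..j. T_coeff n i * T_coeff n k * coord_cov (\<tau> n) i k) + ?b\<^sup>2"
        using jn by (intro second_moment_affine tau_prob coord_integrable[where k=1] coord_integrable(2); auto)+
      have cov_le: "T_coeff n i * T_coeff n k * coord_cov (\<tau> n) i k
          \<le> K\<^sup>2 * (c / n\<^sup>2) + (if i = k then K\<^sup>2 * (c / n) else 0)" if "i \<in> {1..j}" "k \<in> {1..j}" for i k
      proof -
        have ik: "1 \<le> i" "1 \<le> k" "real i < n * \<xi>" "real k < n * \<xi>"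
          using that j by auto
        have cc: "0 \<le> T_coeff n i * T_coeff n k" "T_coeff n i * T_coeff n k \<le> K\<^sup>2"
          using T_coeff_bounds[OF \<xi>(2) ik(3)] T_coeff_bounds[OF \<xi>(2) ik(4)] K
          unfolding power2_eq_square K_def[symmetric] by (auto intro!: mult_mono)
        have "coord_cov (\<tau> n) i k \<le> c / n\<^sup>2 + (if i = k then c / n else 0)"
        proof (cases "i = k")
          case True
          have "coord_cov (\<tau> n) i i \<le> C * e / n"
            using elim(1) ik by blast
          also have "\<dots> \<le> c / n"
            using e(2) by (simp add: divide_right_mono)
          finally show ?thesis
            using True c by (simp add: add_increasing)
        next
          case False
          have "coord_cov (\<tau> n) i k \<le> C * e / n\<^sup>2"
            using elim(1) ik False by (meson abs_le_D1)
          also have "\<dots> \<le> c / n\<^sup>2"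
            using e(2) by (simp add: divide_right_mono)
          finally show ?thesis
            using False by simp
        qed
        then have "T_coeff n i * T_coeff n k * coord_cov (\<tau> n) i k
            \<le> T_coeff n i * T_coeff n k * (c / n\<^sup>2 + (if i = k then c / n else 0))"
          using cc(1) by (rule mult_left_mono)
        also have "\<dots> \<le> K\<^sup>2 * (c / n\<^sup>2 + (if i = k then c / n else 0))"
          using cc(2) c by (intro mult_right_mono) auto
        finally show ?thesis
          by (auto simp: distrib_left)
      qed
      have jn1: "real j / n \<le> 1" "0 \<le> real j / n"
        using jn by auto
      have "(\<Sum>i=1..j. \<Sum>k=1..j. T_coeff n i * T_coeff n k * coord_cov (\<tau> n) i k)
          \<le> (\<Sum>i=1..j. \<Sum>k=1..j. K\<^sup>2 * (c / n\<^sup>2) + (if i = k then K\<^sup>2 * (c / n) else 0))"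
        by (intro sum_mono cov_le)
      also have "\<dots> = K\<^sup>2 * c * (real j / n)\<^sup>2 + K\<^sup>2 * c * (real j / n)"
        by (simp add: sum.distrib power2_eq_square algebra_simps)
      also have "\<dots> \<le> K\<^sup>2 * c * 1 + K\<^sup>2 * c * 1"
        using jn1 c by (intro add_mono mult_left_mono power_le_one) auto
      also have "\<dots> = \<eta> / 2"
        using K by (simp add: c_def)
      finally have var: "(\<Sum>i=1..j. \<Sum>k=1..j. T_coeff n i * T_coeff n k * coord_cov (\<tau> n) i k) \<le> \<eta> / 2" .
      have "\<bar>?b\<bar> \<le> sqrt (\<eta> / 2)"
        using elim(2) j unfolding d_def by (simp add: algebra_simps)
      then have "?b\<^sup>2 \<le> \<eta> / 2"
        using abs_le_square_iff[of ?b "sqrt (\<eta> / 2)"] \<eta> by simp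
      then show "integrable (\<tau> n) (\<lambda>z. (T_map (a n) n z j - \<phi> (j / n))\<^sup>2) \<and>
          (\<integral>z. (T_map (a n) n z j - \<phi> (j / n))\<^sup>2 \<partial>\<tau> n) \<le> \<eta>"
        unfolding T using mom var by simp
    qed
  qed
qed

section \<open>Good configurations and convergence in probability\<close>

text \<open>The sign and sum conditions hold for every image of the simplex when
  \<open>2 \<le> n\<close> and make \<open>W1_emp_measure_le\<close> applicable; the last one is a
  mean square because second moments are what is controlled.\<close>

definition good :: "nat \<Rightarrow> nat \<Rightarrow> real \<Rightarrow> (nat \<Rightarrow> real) set" where
  "good n m \<delta> = {x \<in> space (PiM {1..n} (\<lambda>_. borel)). (\<forall>j\<in>{1..n}. 0 \<le> x j) \<and> (\<Sum>j=1..n. x j) = n \<and>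
    (\<Sum>j=1..m. (x j - \<phi> (j / n))\<^sup>2) / n < \<delta>\<^sup>2}"

lemma good_sets:
  assumes "m \<le> n"
  shows "good n m \<delta> \<in> sets (PiM {1..n} (\<lambda>_. borel))"
proof -
  have [measurable]: "(\<lambda>x. x j) \<in> borel_measurable (PiM {1..n} (\<lambda>_. borel :: real measure))" if "j \<in> {1..n}" for j
    using that by (rule measurable_component_singleton)
  have [measurable]: "(\<lambda>x. \<Sum>j=1..n. x j) \<in> borel_measurable (PiM {1..n} (\<lambda>_. borel :: real measure))"
    by (rule borel_measurable_sum) measurable
  have "(\<lambda>x. (x j - \<phi> (j / n))\<^sup>2) \<in> borel_measurable (PiM {1..n} (\<lambda>_. borel))" if "j \<in> {1..m}" for j
  proof -
    have [measurable]: "(\<lambda>x. x j) \<in> borel_measurable (PiM {1..n} (\<lambda>_. borel :: real measure))"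
      using that assms by (intro measurable_component_singleton) auto
    show ?thesis
      by measurable
  qed
  then have [measurable]: "(\<lambda>x. \<Sum>j=1..m. (x j - \<phi> (j / n))\<^sup>2) \<in> borel_measurable (PiM {1..n} (\<lambda>_. borel))"
    by (rule borel_measurable_sum)
  show ?thesis
    unfolding good_def by measurable
qed

text \<open>Markov's inequality for the averaged squared deviation of the first \<open>m\<close>
  coordinates, the other conditions of \<open>good\<close> holding almost surely.\<close>

lemma prob_not_good:
  fixes \<xi> :: real
  assumes \<xi>: "0 < \<xi>" "\<xi> < 1" and \<delta>: "0 < \<delta>" and \<epsilon>: "0 < \<epsilon>"
  shows "\<forall>\<^sub>F n in sequentially. \<forall>m. real m < n * \<xi> \<longrightarrow>
    measure (\<tau> n) {z \<in> space (\<tau> n). T_map (a n) n z \<notin> good n m \<delta>} < \<epsilon>"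
proof -
  \<comment> \<open>Markov's inequality then gives \<open>\<epsilon> / 2\<close>, so the final bound
    is strict.\<close>
  define \<eta> where "\<eta> = \<delta>\<^sup>2 * \<epsilon> / 2"
  have \<eta>: "0 < \<eta>"
    using \<delta> \<epsilon> by (simp add: \<eta>_def)
  show ?thesis
    using T_map_second_moment[OF \<xi> \<eta>] eventually_ge_at_top[of 2]
  proof eventually_elim
    case (elim n)
    show ?case
    proof (intro allI impI)
      fix m :: nat assume m: "real m < n * \<xi>"
      have n: "1 \<le> n"
        using elim(2) by simp
      interpret prob_space "\<tau> n"
        using n by (rule tau_prob)
      let ?q = "\<lambda>z j. (T_map (a n) n z j - \<phi> (j / n))\<^sup>2"
      let ?Q = "\<lambda>z. (\<Sum>j=1..m. ?q z j) / n"
      have mn: "m \<le> n"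
        using less_of_less_mult[OF \<xi>(2) m] by simp
      have q: "integrable (\<tau> n) (\<lambda>z. ?q z j)" "(\<integral>z. ?q z j \<partial>\<tau> n) \<le> \<eta>" if "j \<in> {1..m}" for j
        using elim(1) that m by auto
      have Q: "integrable (\<tau> n) ?Q"
        using q(1) by (intro integrable_divide Bochner_Integration.integrable_sum) auto
      have "(\<integral>z. ?Q z \<partial>\<tau> n) = (\<Sum>j=1..m. \<integral>z. ?q z j \<partial>\<tau> n) / n"
        using q(1) by (simp add: Bochner_Integration.integral_sum)
      also have "\<dots> \<le> (\<Sum>j=1..m. \<eta>) / n"
        using q(2) by (intro divide_right_mono sum_mono) auto
      also have "\<dots> \<le> \<eta>"
        using mn n \<eta> by (simp add: divide_simps)
      finally have EQ: "(\<integral>z. ?Q z \<partial>\<tau> n) \<le> \<eta>" .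
      have "AE z in \<tau> n. T_map (a n) n z \<notin> good n m \<delta> \<longrightarrow> \<delta>\<^sup>2 \<le> ?Q z"
        using tau_simplex[OF n]
      proof eventually_elim
        case (elim z)
        have "T_map (a n) n z \<in> space (PiM {1..n} (\<lambda>_. borel))"
          by (auto simp: T_map_def space_PiM)
        then show ?case
          using T_map_nonneg[OF elim a_range] sum_T_map[OF elim, of "a n"] \<open>2 \<le> n\<close>
          by (auto simp: good_def)
      qed
      then have "measure (\<tau> n) {z \<in> space (\<tau> n). T_map (a n) n z \<notin> good n m \<delta>}
          \<le> measure (\<tau> n) {z \<in> space (\<tau> n). \<delta>\<^sup>2 \<le> ?Q z}"
        using Q by (intro finite_measure_mono_AE) auto
      also have "\<dots> \<le> (\<integral>z. ?Q z \<partial>\<tau> n) / \<delta>\<^sup>2"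
        using \<delta> by (intro integral_Markov_inequality_measure[OF Q, where A="{}"])
          (auto intro!: sum_nonneg divide_nonneg_nonneg)
      also have "\<dots> \<le> \<eta> / \<delta>\<^sup>2"
        by (rule divide_right_mono[OF EQ]) simp
      also have "\<dots> < \<epsilon>"
        using \<delta> \<epsilon> by (simp add: \<eta>_def)
      finally show "measure (\<tau> n) {z \<in> space (\<tau> n). T_map (a n) n z \<notin> good n m \<delta>} < \<epsilon>" .
    qed
  qed
qed

text \<open>The inequality \<open>\<bar>y\<bar> \<le> y\<^sup>2 / (2 * \<delta>) + \<delta> /
  2\<close> turns a mean square below \<open>\<delta>\<^sup>2\<close> into a mean absolute deviation
  of at most \<delta>.\<close>

lemma W1_good_le:
  assumes x: "x \<in> good n m \<delta>" and mn: "m < n" and \<delta>: "0 < \<delta>"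
  shows "W1 (emp_measure n x) (g_measure \<alpha> w)
    \<le> ereal (2 * (\<delta> + \<phi> (m / n) / n) + 2 * (1 - integral {0..m / n} \<phi>))"
proof -
  have "(\<Sum>j=1..m. \<bar>x j - \<phi> (j / n)\<bar>) / n \<le> \<delta>"
  proof -
    have "\<bar>y\<bar> \<le> y\<^sup>2 / (2 * \<delta>) + \<delta> / 2" for y :: real
      using sum_squares_bound[of "\<bar>y\<bar>" \<delta>] \<delta> by (simp add: divide_simps power2_eq_square)
    then have "(\<Sum>j=1..m. \<bar>x j - \<phi> (j / n)\<bar>) / n
        \<le> (\<Sum>j=1..m. (x j - \<phi> (j / n))\<^sup>2 / (2 * \<delta>) + \<delta> / 2) / n"
      by (intro divide_right_mono sum_mono) auto
    also have "\<dots> = (\<Sum>j=1..m. (x j - \<phi> (j / n))\<^sup>2) / n / (2 * \<delta>) + real m / n * (\<delta> / 2)"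
      by (simp add: sum.distrib sum_divide_distrib[symmetric] add_divide_distrib mult.commute)
    also have "\<dots> \<le> \<delta>\<^sup>2 / (2 * \<delta>) + 1 * (\<delta> / 2)"
      using x mn \<delta> unfolding good_def
      by (intro add_mono divide_right_mono mult_right_mono) auto
    also have "\<dots> = \<delta>"
      using \<delta> by (simp add: power2_eq_square)
    finally show ?thesis .
  qed
  moreover have "W1 (emp_measure n x) (g_measure \<alpha> w)
    \<le> ereal (2 * ((\<Sum>j=1..m. \<bar>x j - \<phi> (j / n)\<bar>) / n + \<phi> (m / n) / n) + 2 * (1 - integral {0..m / n} \<phi>))"
    using x by (intro W1_emp_measure_le mn) (auto simp: good_def)
  ultimately show ?thesis
    by (elim order_trans) simp
qed

text \<open>\<open>W1\<close> is a supremum over an uncountable family, so the event is enclosed in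
  a measurable set \<open>A\<close> instead of being measured itself.\<close>

lemma W1_tendsto_in_prob:
  assumes \<epsilon>: "0 < \<epsilon>" and \<delta>: "0 < \<delta>"
  shows "\<forall>\<^sub>F n in sequentially. \<exists>A\<in>sets (hat_tau \<tau> a n).
    {x \<in> space (hat_tau \<tau> a n). W1 (emp_measure n x) (g_measure \<alpha> w) > ereal \<epsilon>} \<subseteq> A
    \<and> measure (hat_tau \<tau> a n) A < \<delta>"
proof -
  \<comment> \<open>The final bound is twice the sum of three quantities, each at most
    \<open>\<epsilon> / 8\<close>.\<close>
  have \<epsilon>8: "0 < \<epsilon> / 8"
    using \<epsilon> by simp
  obtain s where s: "0 < s" "s < 1" "\<And>t. s \<le> t \<Longrightarrow> t < 1 \<Longrightarrow> 1 - integral {0..t} \<phi> < \<epsilon> / 8"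
    using phi_tail_small[OF \<epsilon>8] by metis
  define \<xi> where "\<xi> = (s + 1) / 2"
  have \<xi>: "0 < \<xi>" "\<xi> < 1" "s < \<xi>"
    using s by (auto simp: \<xi>_def)
  have "(\<lambda>n. \<phi> \<xi> * (1 / n)) \<longlonglongrightarrow> \<phi> \<xi> * 0"
    by (intro tendsto_intros lim_1_over_n)
  then have "\<forall>\<^sub>F n in sequentially. \<phi> \<xi> * (1 / n) < \<epsilon> / 8"
    using \<epsilon>8 by (intro order_tendstoD(2)) auto
  moreover have "\<forall>\<^sub>F n in sequentially. 1 / real n < \<xi> - s"
    using \<xi>(3) by (intro order_tendstoD(2)[OF lim_1_over_n]) simp
  ultimately show ?thesis
    using prob_not_good[OF \<xi>(1,2) \<epsilon>8 \<delta>] eventually_ge_at_top[of 2]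
  proof eventually_elim
    case (elim n)
    have n: "1 \<le> n" "0 < real n"
      using elim(4) by auto
    \<comment> \<open>The least integer with \<open>s \<le> m / n\<close>; since
      \<open>1 / n < \<xi> - s\<close>, rounding up keeps \<open>m / n\<close> below
      \<open>\<xi>\<close>. The lower bound makes the tail small, the upper one allows
      pre-chaoticity to be used.\<close>
    define m where "m = nat \<lceil>n * s\<rceil>"
    have "n * s \<le> m" "m < n * s + 1"
    proof -
      have "0 \<le> n * s"
        using s n by simp
      then have "real m = of_int \<lceil>n * s\<rceil>"
        unfolding m_def by (intro of_nat_nat) (simp add: zero_le_ceiling)
      then show "n * s \<le> m" "m < n * s + 1"
        using ceiling_correct[of "n * s"] by linarith+
    qed
    moreover have "n * s + 1 < n * \<xi>"
      using elim(2) n by (simp add: field_simps)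
    moreover have "n * \<xi> < real n"
      using \<xi> n by simp
    ultimately have "n * s \<le> m" "m < n * \<xi>" "real m < real n"
      by linarith+
    then have m: "s \<le> real m / n" "real m < n * \<xi>" "real m / n \<le> \<xi>" "m < n"
      using n by (auto simp: divide_simps mult.commute)
    have "m \<le> n"
      using m(4) by simp
    have W1: "W1 (emp_measure n x) (g_measure \<alpha> w) \<le> ereal \<epsilon>" if "x \<in> good n m (\<epsilon> / 8)" for x
    proof -
      have "\<phi> (m / n) / n \<le> \<phi> \<xi> * (1 / n)"
        using phi_mono[of "m / n" \<xi>] m \<xi> by (simp add: divide_right_mono)
      then have "\<phi> (m / n) / n \<le> \<epsilon> / 8"
        using elim(1) by linarith
      moreover have "1 - integral {0..m / n} \<phi> < \<epsilon> / 8"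
        using m \<xi> by (intro s(3)) auto
      moreover have "2 * (\<epsilon> / 8 + y) + 2 * (1 - i) \<le> \<epsilon>" if "y \<le> \<epsilon> / 8" "1 - i < \<epsilon> / 8" for y i :: real
        using that \<epsilon> by (simp add: field_simps)
      ultimately have "2 * (\<epsilon> / 8 + \<phi> (m / n) / n) + 2 * (1 - integral {0..m / n} \<phi>) \<le> \<epsilon>"
        by blast
      with W1_good_le[OF that m(4) \<epsilon>8] show ?thesis
        by (meson ereal_less_eq(3) order_trans)
    qed
    obtain A where A: "A \<in> sets (hat_tau \<tau> a n)"
      "\<forall>x\<in>space (hat_tau \<tau> a n) - A. \<exists>\<pi>. \<pi> permutes {1..n} \<and> (\<lambda>j\<in>{1..n}. x (\<pi> j)) \<in> good n m (\<epsilon> / 8)"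
      "measure (hat_tau \<tau> a n) A \<le> measure (\<tau> n) {z \<in> space (\<tau> n). T_map (a n) n z \<notin> good n m (\<epsilon> / 8)}"
      using hat_tau_cover[where \<tau>=\<tau> and n=n and a=a, OF tau_prob[OF n(1)] tau_sets[OF n(1)]
          good_sets[OF \<open>m \<le> n\<close>, of "\<epsilon> / 8"]] by blast
    have "W1 (emp_measure n x) (g_measure \<alpha> w) \<le> ereal \<epsilon>" if x: "x \<in> space (hat_tau \<tau> a n) - A" for x
    proof -
      obtain \<pi> where \<pi>: "\<pi> permutes {1..n}" "(\<lambda>j\<in>{1..n}. x (\<pi> j)) \<in> good n m (\<epsilon> / 8)"
        using A(2) x by blast
      show ?thesis
        using W1[OF \<pi>(2)] unfolding emp_measure_permute[OF \<pi>(1)] .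
    qed
    then have "{x \<in> space (hat_tau \<tau> a n). W1 (emp_measure n x) (g_measure \<alpha> w) > ereal \<epsilon>} \<subseteq> A"
      by (auto simp: not_le[symmetric])
    then show ?case
      using A(1,3) elim(3) m(2) by (meson le_less_trans)
  qed
qed

end

theorem theorem3p5:
  fixes \<alpha> :: real and w :: "real \<Rightarrow> real"
    and \<tau> :: "nat \<Rightarrow> (nat \<Rightarrow> real) measure" and a :: "nat \<Rightarrow> real"
  assumes alpha: "0 < \<alpha>" "\<alpha> < 2"
    and w_nonneg: "\<forall>t\<in>{0..1}. 0 \<le> w t"
    and w_int: "(w has_integral 1) {0..1}"
    and w_cont: "continuous_on {0..<1} w"
    and tau_prob: "\<forall>n\<ge>1. prob_space (\<tau> n) \<and> sets (\<tau> n) = sets (PiM {1..n} (\<lambda>_. borel))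
                          \<and> (AE z in \<tau> n. z \<in> std_simplex n)"
    and tau_chaotic: "pre_chaotic w \<tau>"
    and a_range: "\<forall>n. 0 < a n \<and> a n < 2"
    and a_lim: "a \<longlonglongrightarrow> \<alpha>"
  shows "((\<forall>x. 0 \<le> g_dens \<alpha> w x) \<and> (g_dens \<alpha> w has_integral 1) {0..})
    \<and> (\<forall>\<epsilon>>0. \<forall>\<delta>>0. \<exists>N. \<forall>n\<ge>N. \<exists>A\<in>sets (hat_tau \<tau> a n).
           {x \<in> space (hat_tau \<tau> a n). W1 (emp_measure n x) (g_measure \<alpha> w) > ereal \<epsilon>} \<subseteq> A
           \<and> measure (hat_tau \<tau> a n) A < \<delta>)"
proof -
  interpret chaotic_simplices \<alpha> w \<tau> a
  proof (intro chaotic_simplices.intro limit_profile.intro chaotic_simplices_axioms.intro)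
    show "0 \<le> w t" if "t \<in> {0..1}" for t
      using w_nonneg that ..
    fix n :: nat
    show "prob_space (\<tau> n)" "sets (\<tau> n) = sets (PiM {1..n} (\<lambda>_. borel))" "AE z in \<tau> n. z \<in> std_simplex n"
      if "1 \<le> n"
      using tau_prob[rule_format, OF that] by blast+
    show "0 < a n" "a n < 2"
      using a_range by simp_all
  qed (fact alpha w_int w_cont tau_chaotic a_lim)+
  show ?thesis
    using W1_tendsto_in_prob
    by (intro conjI allI impI g_dens_nonneg g_dens_has_integral) (simp only: eventually_sequentially)
qed

end
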